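(* Let $\tilde P$ be an affine poset of order $|\tilde P|=n\ge1$. Let $\mathcal{K}(\tilde P)$ be the abstract simplicial complex whose vertices are the equivalence classes of proper $\tilde P$-pipes and whose simplices correspond to proper $\tilde P$-pipings (each proper piping giving the finite set of equivalence classes of pipes contained in it). Then there exists a simplicial $(|\tilde P|-1)$-dimensional convex polytope $\mathcal{C}(\tilde P)^*$ whose boundary complex is isomorphic to $\mathcal{K}(\tilde P)$.
   Context: An affine poset of order $n\ge1$ is a poset $\tilde P=(\mathbb{Z},\preceq)$ such that: (1) $i\prec i+n$ for all $i\in\mathbb{Z}$; (2) for all $i,j\in\mathbb{Z}$, $i\preceq j$ if and only if $i+n\preceq j+n$; (3) for all $i,j\in\mathbb{Z}$ there is $k\ge0$ with $i\preceq j+kn$. Its order is denoted $|\tilde P|=n$. A subset $\tau\subseteq\mathbb{Z}$ is convex if $i\prec j\prec k$ with $i,k\in\tau$ implies $j\in\tau$, and connected if the subgraph of the Hasse diagram of $\tilde P$ induced by $\tau$ is connected. A ($\tilde P$-)pipe is a nonempty convex connected subset of $\mathbb{Z}$ which either equals $\mathbb{Z}$ (also denoted $\tilde P$) or contains at most one element in each residue class modulo $n$. Pipes $\tau$ and $\tau+dn=\{i+dn: i\in\tau\}$, $d\in\mathbb{Z}$, are called equivalent. A collection of pipes is $n$-periodic if it is a union of equivalence classes. A ($\tilde P$-)piping is an $n$-periodic collection $\mathbf{T}$ of pipes such that any two pipes in $\mathbf{T}$ are nested (one contains the other) or disjoint, and such that the directed graph with vertex set $\mathbf{T}$ and edge set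 $\{(\tau,\tau')\in\mathbf{T}^2:\tau\cap\tau'=\emptyset\text{ and } i\prec j\text{ for some }i\in\tau,j\in\tau'\}$ has no directed cycles. A pipe $\tau$ is proper if $|\tau|>1$ and $\tau\ne\tilde P$. A piping is proper if it consists of proper pipes (the empty collection is allowed). Each piping is a union of finitely many equivalence classes of pipes. *)

theory Defs
  imports "HOL-Analysis.Analysis"
begin

section \<open>Affine posets\<close>

definition strict :: "('a \<Rightarrow> 'a \<Rightarrow> bool) \<Rightarrow> 'a \<Rightarrow> 'a \<Rightarrow> bool" where
  "strict le i j \<longleftrightarrow> le i j \<and> i \<noteq> j"

definition affine_poset :: "nat \<Rightarrow> (int \<Rightarrow> int \<Rightarrow> bool) \<Rightarrow> bool" where
  "affine_poset n le \<longleftrightarrow>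
     n \<ge> 1 \<and> reflp le \<and> transp le \<and> antisymp le \<and>
     (\<forall>i. strict le i (i + int n)) \<and>
     (\<forall>i j. le i j \<longleftrightarrow> le (i + int n) (j + int n)) \<and>
     (\<forall>i j. \<exists>k::nat. le i (j + int k * int n))"

section \<open>Pipes\<close>

definition poset_convex :: "('a \<Rightarrow> 'a \<Rightarrow> bool) \<Rightarrow> 'a set \<Rightarrow> bool" where
  "poset_convex le t \<longleftrightarrow>
     (\<forall>i j k. i \<in> t \<and> k \<in> t \<and> strict le i j \<and> strict le j k \<longrightarrow> j \<in> t)"

definition covers :: "('a \<Rightarrow> 'a \<Rightarrow> bool) \<Rightarrow> 'a \<Rightarrow> 'a \<Rightarrow> bool" where
  "covers le i j \<longleftrightarrow> strict le i j \<and> \<not> (\<exists>k. strict le i k \<and> strict le k j)"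

definition hasse_connected :: "('a \<Rightarrow> 'a \<Rightarrow> bool) \<Rightarrow> 'a set \<Rightarrow> bool" where
  "hasse_connected le t \<longleftrightarrow>
     (\<forall>i\<in>t. \<forall>j\<in>t. (i, j) \<in> {(a, b). a \<in> t \<and> b \<in> t \<and> (covers le a b \<or> covers le b a)}\<^sup>*)"

definition pipe :: "nat \<Rightarrow> (int \<Rightarrow> int \<Rightarrow> bool) \<Rightarrow> int set \<Rightarrow> bool" where
  "pipe n le t \<longleftrightarrow>
     t \<noteq> {} \<and> poset_convex le t \<and> hasse_connected le t \<and>
     (t = UNIV \<or> inj_on (\<lambda>i. i mod int n) t)"

text \<open>For \<open>n \<ge> 1\<close> a pipe other than \<open>UNIV\<close> is finite, so \<open>card\<close> is its true cardinality.\<close>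

definition proper_pipe :: "nat \<Rightarrow> (int \<Rightarrow> int \<Rightarrow> bool) \<Rightarrow> int set \<Rightarrow> bool" where
  "proper_pipe n le t \<longleftrightarrow> pipe n le t \<and> card t > 1 \<and> t \<noteq> UNIV"

definition pipe_class :: "nat \<Rightarrow> int set \<Rightarrow> int set set" where
  "pipe_class n t = {(\<lambda>i. i + d * int n) ` t | d :: int. True}"

section \<open>Pipings\<close>

definition periodic_pipes :: "nat \<Rightarrow> (int \<Rightarrow> int \<Rightarrow> bool) \<Rightarrow> int set set \<Rightarrow> bool" where
  "periodic_pipes n le T \<longleftrightarrow> (\<exists>E. E \<subseteq> pipe_class n ` {t. pipe n le t} \<and> T = \<Union>E)"

definition piping_digraph :: "(int \<Rightarrow> int \<Rightarrow> bool) \<Rightarrow> int set set \<Rightarrow> (int set \<times> int set) set" where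
  "piping_digraph le T =
     {(s, t). s \<in> T \<and> t \<in> T \<and> s \<inter> t = {} \<and> (\<exists>i\<in>s. \<exists>j\<in>t. strict le i j)}"

definition piping :: "nat \<Rightarrow> (int \<Rightarrow> int \<Rightarrow> bool) \<Rightarrow> int set set \<Rightarrow> bool" where
  "piping n le T \<longleftrightarrow>
     periodic_pipes n le T \<and>
     (\<forall>s\<in>T. \<forall>t\<in>T. s \<subseteq> t \<or> t \<subseteq> s \<or> s \<inter> t = {}) \<and>
     acyclic (piping_digraph le T)"

definition proper_piping :: "nat \<Rightarrow> (int \<Rightarrow> int \<Rightarrow> bool) \<Rightarrow> int set set \<Rightarrow> bool" where
  "proper_piping n le T \<longleftrightarrow> piping n le T \<and> (\<forall>t\<in>T. proper_pipe n le t)"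

section \<open>Simplicial complexes and polytopes\<close>

text \<open>An abstract simplicial complex is given by its vertex set and its set of simplices,
  the empty simplex included.\<close>

type_synonym 'v scomplex = "'v set \<times> 'v set set"

definition scomplex_iso :: "'v scomplex \<Rightarrow> 'w scomplex \<Rightarrow> bool" where
  "scomplex_iso K L \<longleftrightarrow>
     (\<exists>f. bij_betw f (fst K) (fst L) \<and> (\<lambda>S. f ` S) ` snd K = snd L)"

definition piping_complex :: "nat \<Rightarrow> (int \<Rightarrow> int \<Rightarrow> bool) \<Rightarrow> int set set scomplex" where
  "piping_complex n le =
     (pipe_class n ` {t. proper_pipe n le t},
      {pipe_class n ` T | T. proper_piping n le T})"

text \<open>The empty set is a face, and is a \<open>(-1)\<close>-simplex in the sense of \<open>simplex\<close>.\<close>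

definition simplicial_polytope :: "'a::euclidean_space set \<Rightarrow> bool" where
  "simplicial_polytope C \<longleftrightarrow>
     polytope C \<and> (\<forall>F. F face_of C \<and> F \<noteq> C \<longrightarrow> (\<exists>k. k simplex F))"

text \<open>The simplices are the vertex sets of the proper faces. The vertices are those of the proper
  faces; this excludes the single point of a 0-dimensional polytope, whose boundary is empty.\<close>

definition boundary_complex :: "'a::euclidean_space set \<Rightarrow> 'a scomplex" where
  "boundary_complex C =
     ({v. \<exists>F. F face_of C \<and> F \<noteq> C \<and> v extreme_point_of F},
      {{v. v extreme_point_of F} | F. F face_of C \<and> F \<noteq> C})"

end

theory Submission
  imports Defs
begin

text \<open>
  Consider functions \<open>x : \<int> \<rightarrow> \<real>\<close> with \<open>x (i + n) = x i + L\<close>, modulo constants,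
  and for a proper pipe \<open>t\<close> let
  \<open>f\<^sub>t(x)\<close> be the sum of \<open>x j - x i\<close> over all \<open>i \<prec> j\<close> in \<open>t\<close>. For \<open>M\<close> large and \<open>L = n M\<^sup>n\<^sup>+\<^sup>1\<close>, the inequalities
  \<open>f\<^sub>t(x) \<ge> M\<^sup>|\<^sup>t\<^sup>|\<close> define a simple polytope whose polar dual is the polytope sought.

  The pipes active at a feasible point form a piping: two tubes that overlap, or that lie on a common
  cycle, would have values so close together that the order-convex hull of their union is a pipe
  violating its own inequality.

  Conversely, given a piping, order the maximal proper subtubes of each of its tubes linearly, place
  them at integer heights, and choose the scales of the tubes from the inside out so that each tube
  of the piping becomes active. All other inequalities are then strict, because the scale of a tube exceeds
  \<open>M\<^sup>|\<^sup>s\<^sup>|\<close> for every smaller pipe \<open>s\<close>. As pipings are closed under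
  taking subcollections, the active functionals are linearly independent, so faces are simplices.
\<close>

section \<open>Polar duality\<close>

text \<open>Only ratios of scales matter. A gap sum has at most n^2 terms, so if the values on a
  pipe \<open>r\<close> spread over at most \<open>M ^ (card r - 1)\<close> times a factor depending
  on n alone, the inequality of \<open>r\<close> fails for large \<open>M\<close>.
  \<open>UNIV\<close> acts as an outermost tube with n + 1 elements: its scale is
  \<open>M ^ Suc n\<close>, and since a height grows by n over one period, the period constant L is
  n times this scale. A directed cycle of tubes may be arbitrarily long, so adding up diameters
  along it gives no bound in terms of n. Periodicity does: with only n residue classes, one of n
  consecutive windows of the real line contains no value, and no tube of the cycle can jump over it.
  \<open>M\<close> has to be fixed before any piping is given, whereas heights depend on the piping.
  This is possible because sufficiently distant integers are comparable, which bounds the variation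
  of every height on every pipe by a constant \<open>B\<close> depending on the poset alone.\<close>

lemma convex_hull_Int_supporting_hyperplane:
  fixes X :: "'a::euclidean_space set"
  assumes "finite X" "b > 0" and le: "\<And>y. y \<in> X \<Longrightarrow> a \<bullet> y \<le> b"
  defines "C \<equiv> convex hull (insert 0 X)"
  shows "C \<inter> {y. a \<bullet> y = b} = convex hull {y \<in> X. a \<bullet> y = b}"
    and "C \<inter> {y. a \<bullet> y = b} face_of C" and "C \<inter> {y. a \<bullet> y = b} \<noteq> C"
proof -
  have "insert 0 X \<subseteq> {y. a \<bullet> y \<le> b}" using assms by auto
  then have C: "C \<subseteq> {y. a \<bullet> y \<le> b}"
    unfolding C_def by (intro hull_minimal convex_halfspace_le)
  show face: "C \<inter> {y. a \<bullet> y = b} face_of C"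
    using C by (intro face_of_Int_supporting_hyperplane_le) (auto simp: C_def)
  have "0 \<in> C" by (simp add: C_def hull_inc)
  then show "C \<inter> {y. a \<bullet> y = b} \<noteq> C" using \<open>b > 0\<close> by force
  obtain S where S: "S \<subseteq> insert 0 X" "C \<inter> {y. a \<bullet> y = b} = convex hull S"
    using face_of_convex_hull_subset[OF _ face[unfolded C_def]] assms(1)
    by (metis C_def finite_imp_compact finite_insert)
  then have "a \<bullet> y = b" if "y \<in> S" for y using that hull_subset by fastforce
  \<comment> \<open>Positivity of \<open>b\<close> keeps 0 off the hyperplane, so the extra
    generator 0 contributes nothing to the face.\<close>
  then have "S \<subseteq> {y \<in> X. a \<bullet> y = b}" using S(1) \<open>b > 0\<close> by force
  then have "C \<inter> {y. a \<bullet> y = b} \<subseteq> convex hull {y \<in> X. a \<bullet> y = b}"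
    using S(2) by (simp add: hull_mono)
  moreover have "convex hull {y \<in> X. a \<bullet> y = b} \<subseteq> C"
    unfolding C_def by (intro hull_mono) auto
  moreover have "convex hull {y \<in> X. a \<bullet> y = b} \<subseteq> {y. a \<bullet> y = b}"
    by (intro hull_minimal convex_hyperplane) auto
  ultimately show "C \<inter> {y. a \<bullet> y = b} = convex hull {y \<in> X. a \<bullet> y = b}" by blast
qed

text \<open>The polar dual of the polytope \<open>{a. \<forall>i\<in>I. a \<bullet> v i \<le> 1}\<close>: a face of the hull corresponds to
  the set of inequalities active at a point of that polytope.\<close>

lemma polar_dual_simplicial:
  fixes v :: "'i \<Rightarrow> 'a::euclidean_space"
  assumes fin: "finite I"
    and rec: "\<And>a. (\<And>i. i \<in> I \<Longrightarrow> a \<bullet> v i \<le> 0) \<Longrightarrow> (\<And>i. i \<in> I \<Longrightarrow> a \<bullet> v i = 0)"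
    and act: "\<And>a. (\<And>i. i \<in> I \<Longrightarrow> a \<bullet> v i \<le> 1) \<Longrightarrow> {i \<in> I. a \<bullet> v i = 1} \<in> K"
    and att: "\<And>S. S \<in> K \<Longrightarrow> \<exists>a. (\<forall>i\<in>I. a \<bullet> v i \<le> 1) \<and> {i \<in> I. a \<bullet> v i = 1} = S"
    and sub: "\<And>S S'. S \<in> K \<Longrightarrow> S' \<subseteq> S \<Longrightarrow> S' \<in> K"
    and vert: "\<And>i. i \<in> I \<Longrightarrow> {i} \<in> K"
  defines "C \<equiv> convex hull (insert 0 (v ` I))"
  shows "simplicial_polytope C" and "aff_dim C = int (dim (v ` I))"
    and "scomplex_iso (boundary_complex C) (I, K)"
proof -
  have KI: "S \<subseteq> I" if "S \<in> K" for S
    using att[OF that] by auto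
  have inj: "inj_on v I"
  proof (rule inj_onI)
    fix i j assume ij: "i \<in> I" "j \<in> I" "v i = v j"
    then obtain a where "{k \<in> I. a \<bullet> v k = 1} = {i}"
      using att[OF vert[OF ij(1)]] by blast
    then show "i = j" using ij by (metis (mono_tags, lifting) mem_Collect_eq singletonD singletonI)
  qed
  \<comment> \<open>Functionals attaining \<open>S\<close> and \<open>S - {i}\<close> agree on the
    other vectors of \<open>S\<close>; a dependence would force them to agree on \<open>v i\<close>
    as well.\<close>
  have indep: "\<not> affine_dependent (v ` S)" if S: "S \<in> K" for S
  proof
    assume "affine_dependent (v ` S)"
    then have "dependent (v ` S)" by (rule affine_dependent_imp_dependent)
    then obtain i where i: "i \<in> S" "v i \<in> span (v ` S - {v i})"
      by (auto simp: dependent_def)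
    have eq: "v ` S - {v i} = v ` (S - {i})"
      using KI[OF S] inj i by (auto simp: inj_on_def)
    obtain a where a: "\<forall>i\<in>I. a \<bullet> v i \<le> 1" "{i \<in> I. a \<bullet> v i = 1} = S"
      using att[OF S] by auto
    have "S - {i} \<in> K" using S by (rule sub) auto
    then obtain a' where a': "\<forall>i\<in>I. a' \<bullet> v i \<le> 1" "{i \<in> I. a' \<bullet> v i = 1} = S - {i}"
      using att by blast
    have "v ` (S - {i}) \<subseteq> {y. (a - a') \<bullet> y = 0}"
      using a a' KI[OF S] by (auto simp: inner_diff_left)
    then have "span (v ` (S - {i})) \<subseteq> {y. (a - a') \<bullet> y = 0}"
      by (intro span_minimal subspace_hyperplane)
    then have "(a - a') \<bullet> v i = 0" using i eq by auto
    then have "a' \<bullet> v i = 1" using a i by (auto simp: inner_diff_left)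
    then show False using a' i KI[OF S] by blast
  qed
  have ext: "{y. y extreme_point_of (convex hull (v ` S))} = v ` S" if "S \<in> K" for S
    using indep[OF that] by (auto simp: extreme_point_of_convex_hull_affine_independent)
  have simplex: "\<exists>k. k simplex (convex hull (v ` S))" if "S \<in> K" for S
    using indep[OF that] unfolding simplex_def by (metis diff_add_cancel)
  have polytope: "polytope C"
    unfolding C_def using fin by (intro polytope_convex_hull) auto
  have 0: "0 \<in> C" by (simp add: C_def hull_inc)
  have face1: "\<exists>S\<in>K. F = convex hull (v ` S)" if F: "F face_of C" "F \<noteq> C" for F
  proof -
    have "F exposed_face_of C"
      using F exposed_face_of_polyhedron polytope polytope_imp_polyhedron by blast
    then obtain a b where ab: "C \<subseteq> {x. a \<bullet> x \<le> b}" "F = C \<inter> {x. a \<bullet> x = b}"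
      by (auto simp: exposed_face_of_def)
    have vC: "v i \<in> C" if "i \<in> I" for i
      using that by (simp add: C_def hull_inc)
    have "b \<ge> 0" using 0 ab by auto
    \<comment> \<open>By \<open>rec\<close>, a supporting hyperplane through 0 contains the whole
      polytope. So a proper face has \<open>b > 0\<close>, and its functional can be rescaled to
      right-hand side 1.\<close>
    moreover have "b \<noteq> 0"
    proof
      assume "b = 0"
      then have "\<And>i. i \<in> I \<Longrightarrow> a \<bullet> v i = 0" using ab vC by (intro rec) auto
      then have "C \<subseteq> {x. a \<bullet> x = b}"
        unfolding C_def using \<open>b = 0\<close> by (intro hull_minimal convex_hyperplane) auto
      then show False using ab F by blast
    qed
    ultimately have b: "b > 0" by simp
    let ?a = "a /\<^sub>R b"
    have le: "?a \<bullet> v i \<le> 1" if "i \<in> I" for i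
      using ab vC[OF that] b by (auto simp: field_simps)
    have "F = convex hull {y \<in> v ` I. a \<bullet> y = b}"
      using convex_hull_Int_supporting_hyperplane(1)[of "v ` I" b a] fin b ab vC
      by (auto simp: C_def)
    also have "{y \<in> v ` I. a \<bullet> y = b} = v ` {i \<in> I. ?a \<bullet> v i = 1}"
      using b by (auto simp: field_simps)
    finally show ?thesis using act[of ?a] le by blast
  qed
  have face2: "convex hull (v ` S) face_of C \<and> convex hull (v ` S) \<noteq> C" if "S \<in> K" for S
  proof -
    obtain a where a: "\<forall>i\<in>I. a \<bullet> v i \<le> 1" "{i \<in> I. a \<bullet> v i = 1} = S"
      using att[OF \<open>S \<in> K\<close>] by auto
    have eq: "{y \<in> v ` I. a \<bullet> y = 1} = v ` S" using a by auto
    have "finite (v ` I)" "(0::real) < 1" "\<And>y. y \<in> v ` I \<Longrightarrow> a \<bullet> y \<le> 1"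
      using fin a by auto
    from convex_hull_Int_supporting_hyperplane[OF this] show ?thesis by (simp add: C_def eq)
  qed
  show "simplicial_polytope C"
    unfolding simplicial_polytope_def using polytope face1 simplex by blast
  have "aff_dim C = int (dim (insert 0 (v ` I)))"
    unfolding C_def aff_dim_convex_hull by (intro aff_dim_zero) (simp add: hull_inc)
  then show "aff_dim C = int (dim (v ` I))" by (metis dim_span span_insert_0)
  have fst: "fst (boundary_complex C) = v ` I"
  proof
    show "fst (boundary_complex C) \<subseteq> v ` I"
      unfolding boundary_complex_def using face1 ext KI by fastforce
    show "v ` I \<subseteq> fst (boundary_complex C)"
    proof clarify
      fix i assume i: "i \<in> I"
      then show "v i \<in> fst (boundary_complex C)"
        using face2[OF vert[OF i]] ext[OF vert[OF i]] by (force simp: boundary_complex_def)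
    qed
  qed
  have "snd (boundary_complex C) = (\<lambda>S. v ` S) ` K"
    unfolding boundary_complex_def using face1 face2 ext by (auto simp: image_iff) metis+
  moreover have cancel: "inv_into I v ` v ` S = S" if "S \<in> K" for S
    using inv_into_image_cancel[OF inj KI[OF that]] .
  have "((`) (inv_into I v) \<circ> (`) v) ` K = id ` K"
    by (rule image_cong) (simp_all add: cancel)
  then have "(`) (inv_into I v) ` (`) v ` K = K"
    by (simp only: image_comp image_id id_apply)
  ultimately have "(\<lambda>S. inv_into I v ` S) ` snd (boundary_complex C) = K" by simp
  moreover have "bij_betw (inv_into I v) (v ` I) I"
    using inj by (intro bij_betw_inv_into) (simp add: bij_betw_def)
  ultimately show "scomplex_iso (boundary_complex C) (I, K)"
    unfolding scomplex_iso_def by (intro exI[of _ "inv_into I v"]) (simp add: fst)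
qed

section \<open>Affine posets and pipes\<close>

locale affine_order =
  fixes n :: nat and le :: "int \<Rightarrow> int \<Rightarrow> bool"
  assumes affine: "affine_poset n le"
begin

abbreviation lt :: "int \<Rightarrow> int \<Rightarrow> bool" where "lt \<equiv> strict le"

abbreviation shift :: "int \<Rightarrow> int set \<Rightarrow> int set" where
  "shift d t \<equiv> (\<lambda>i. i + d * int n) ` t"

lemma n_pos: "n \<ge> 1"
  using affine by (simp add: affine_poset_def)

lemma le_refl [simp]: "le i i"
  using affine by (simp add: affine_poset_def reflp_def)

lemma le_trans: "le i j \<Longrightarrow> le j k \<Longrightarrow> le i k"
  using affine unfolding affine_poset_def by (metis transpD)

lemma le_antisym: "le i j \<Longrightarrow> le j i \<Longrightarrow> i = j"
  using affine unfolding affine_poset_def by (metis antisympD)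

lemma lt_trans: "lt i j \<Longrightarrow> lt j k \<Longrightarrow> lt i k"
  unfolding strict_def using le_trans le_antisym by blast

lemma lt_imp_le: "lt i j \<Longrightarrow> le i j"
  by (simp add: strict_def)

lemma le_shift [simp]: "le (i + d * int n) (j + d * int n) \<longleftrightarrow> le i j"
proof -
  have one: "le (i + int n) (j + int n) \<longleftrightarrow> le i j" for i j
    using affine unfolding affine_poset_def by blast
  have nat: "le (i + int k * int n) (j + int k * int n) \<longleftrightarrow> le i j" for k i j
  proof (induction k)
    case (Suc k)
    then show ?case
      using one[of "i + int k * int n" "j + int k * int n"] by (simp add: algebra_simps)
  qed simp
  show ?thesis
  proof (cases "d \<ge> 0")
    case True
    then show ?thesis using nat[of i "nat d" j] by simp
  next
    case False
    then show ?thesis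
      using nat[of "i + d * int n" "nat (- d)" "j + d * int n"] by (simp add: algebra_simps)
  qed
qed

lemma lt_shift [simp]: "lt (i + d * int n) (j + d * int n) \<longleftrightarrow> lt i j"
  by (simp add: strict_def)

lemma le_add_mult: "d \<ge> 0 \<Longrightarrow> le i (i + d * int n)"
proof (induction d rule: int_ge_induct)
  case (step d)
  have "le (i + d * int n) (i + d * int n + int n)"
    using affine unfolding affine_poset_def strict_def by blast
  then show ?case using le_trans[OF step.IH] by (simp add: algebra_simps)
qed simp

text \<open>The third axiom gives a multiple of n for each pair of integers; by periodicity only the
  finitely many pairs of residues count, and a maximum over these makes the bound uniform.\<close>

lemma far_le:
  obtains c where "c \<ge> 0" "\<And>i j. i + c \<le> j \<Longrightarrow> le i j"
proof -
  let ?R = "{0..<int n}"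
  have "\<forall>i j. \<exists>k::nat. le i (j + int k * int n)"
    using affine by (simp add: affine_poset_def)
  then obtain k :: "int \<Rightarrow> int \<Rightarrow> nat" where k: "\<And>i j. le i (j + int (k i j) * int n)"
    by metis
  define m where "m = int (Max (insert 0 ((\<lambda>(r, s). k r s) ` (?R \<times> ?R))))"
  have km: "int (k r s) \<le> m" if "r \<in> ?R" "s \<in> ?R" for r s
    unfolding m_def using that by (intro of_nat_mono Max_ge) auto
  have rs: "le r (s + q * int n)" if "r \<in> ?R" "s \<in> ?R" "m \<le> q" for r s q
  proof -
    have "le (s + int (k r s) * int n) (s + int (k r s) * int n + (q - int (k r s)) * int n)"
      using km[of r s] that by (intro le_add_mult) auto
    then show ?thesis using le_trans[OF k[of r s]] by (simp add: algebra_simps)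
  qed
  have "le i j" if "i + (m + 1) * int n \<le> j" for i j
  proof -
    let ?r = "i mod int n" and ?s = "j mod int n" and ?a = "i div int n" and ?b = "j div int n"
    have "i = ?r + ?a * int n" "j = ?s + ?b * int n" by simp_all
    then have "?r + ?a * int n + (m + 1) * int n \<le> ?s + ?b * int n"
      using that by linarith
    moreover have "?s < int n" "?r \<ge> 0" using n_pos by auto
    moreover have "(?a + m + 1) * int n = ?a * int n + (m + 1) * int n"
      "(?b + 1) * int n = ?b * int n + int n"
      by (simp_all add: algebra_simps)
    ultimately have "(?a + m + 1) * int n < (?b + 1) * int n"
      by linarith
    then have "m \<le> ?b - ?a" using n_pos by (simp add: mult_less_cancel_right)
    then have "le ?r (?s + (?b - ?a) * int n)"
      using n_pos by (intro rs) auto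
    then have "le (?r + ?a * int n) (?s + (?b - ?a) * int n + ?a * int n)"
      by (simp only: le_shift)
    then show ?thesis by (simp add: algebra_simps)
  qed
  moreover have "(m + 1) * int n \<ge> 0" by (simp add: m_def)
  ultimately show thesis using that by blast
qed

lemma finite_interval: "finite {k. le a k \<and> le k b}"
proof -
  obtain c where c: "c \<ge> 0" "\<And>i j. i + c \<le> j \<Longrightarrow> le i j"
    using far_le by blast
  have "j \<ge> i - c" if "le i j" for i j
    using c(1) c(2)[of j i] that le_antisym by force
  then have "{k. le a k \<and> le k b} \<subseteq> {a - c..b + c}" by force
  then show ?thesis using finite_subset by blast
qed

text \<open>Intervals are finite, so inserting intermediate elements terminates. The chain is
  confined to the interval in order that convex sets absorb it.\<close>

lemma covers_chain:
  "le a b \<Longrightarrow> (a, b) \<in> {(p, q). covers le p q \<and> le a p \<and> le q b}\<^sup>*"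
proof (induction "card {k. le a k \<and> le k b}" arbitrary: a b rule: less_induct)
  case less
  let ?I = "\<lambda>a b. {k. le a k \<and> le k b}" and ?R = "\<lambda>a b. {(p, q). covers le p q \<and> le a p \<and> le q b}"
  show ?case
  proof (cases "a = b \<or> covers le a b")
    case True
    then show ?thesis using less.prems by (elim disjE) (auto intro: r_into_rtrancl)
  next
    case False
    then obtain k where k: "lt a k" "lt k b"
      using less.prems by (auto simp: covers_def strict_def)
    have "b \<notin> ?I a k" "a \<notin> ?I k b" using k le_antisym by (auto simp: strict_def)
    moreover have "?I a k \<subseteq> ?I a b" "?I k b \<subseteq> ?I a b" "a \<in> ?I a b" "b \<in> ?I a b"
      using k less.prems le_trans by (auto simp: strict_def)
    ultimately have "?I a k \<subset> ?I a b" "?I k b \<subset> ?I a b" by blast+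
    then have "card (?I a k) < card (?I a b)" "card (?I k b) < card (?I a b)"
      by (simp_all add: finite_interval psubset_card_mono)
    then have "(a, k) \<in> (?R a k)\<^sup>*" "(k, b) \<in> (?R k b)\<^sup>*"
      using less.hyps k by (auto simp: strict_def)
    moreover have "(?R a k)\<^sup>* \<subseteq> (?R a b)\<^sup>*" "(?R k b)\<^sup>* \<subseteq> (?R a b)\<^sup>*"
      using k le_trans by (intro rtrancl_mono; force simp: strict_def)+
    ultimately show ?thesis by (meson rtrancl_trans subsetD)
  qed
qed

lemma poset_convexD: "poset_convex le t \<Longrightarrow> i \<in> t \<Longrightarrow> k \<in> t \<Longrightarrow> le i j \<Longrightarrow> le j k \<Longrightarrow> j \<in> t"
  unfolding poset_convex_def strict_def by blast

text \<open>In a convex set the cover chain between two comparable elements never leaves the set, so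
  comparability may replace covering when connectedness is checked.\<close>

lemma hasse_connectedI:
  assumes conv: "poset_convex le t"
    and conn: "\<And>i j. i \<in> t \<Longrightarrow> j \<in> t \<Longrightarrow> (i, j) \<in> {(a, b). a \<in> t \<and> b \<in> t \<and> (le a b \<or> le b a)}\<^sup>*"
  shows "hasse_connected le t"
proof -
  let ?H = "{(a, b). a \<in> t \<and> b \<in> t \<and> (covers le a b \<or> covers le b a)}"
  have le: "(a, b) \<in> ?H\<^sup>*" if "a \<in> t" "b \<in> t" "le a b" for a b
  proof -
    have "{(p, q). covers le p q \<and> le a p \<and> le q b} \<subseteq> ?H"
    proof clarify
      fix p q assume pq: "covers le p q" "le a p" "le q b"
      then have "le p q" by (simp add: covers_def strict_def)
      then show "p \<in> t \<and> q \<in> t \<and> (covers le p q \<or> covers le q p)"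
        using pq that poset_convexD[OF conv] le_trans by blast
    qed
    then show ?thesis using covers_chain[OF that(3)] rtrancl_mono by blast
  qed
  have "sym (?H\<^sup>*)" by (intro sym_rtrancl) (auto simp: sym_def)
  then have "{(a, b). a \<in> t \<and> b \<in> t \<and> (le a b \<or> le b a)} \<subseteq> ?H\<^sup>*"
    using le by (auto dest: symD)
  then have "{(a, b). a \<in> t \<and> b \<in> t \<and> (le a b \<or> le b a)}\<^sup>* \<subseteq> ?H\<^sup>*"
    by (rule rtrancl_subset_rtrancl)
  then show ?thesis unfolding hasse_connected_def using conn by blast
qed

section \<open>Elementary properties of proper pipes\<close>

lemma proper_pipe_inj: "proper_pipe n le t \<Longrightarrow> inj_on (\<lambda>i. i mod int n) t"
  by (auto simp: proper_pipe_def pipe_def)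

lemma proper_pipe_finite: "proper_pipe n le t \<Longrightarrow> finite t"
  by (metis card.infinite not_less_zero proper_pipe_def)

lemma proper_pipe_card_le:
  assumes "proper_pipe n le t"
  shows "card t \<le> n"
proof -
  have "card t = card ((\<lambda>i. i mod int n) ` t)"
    using proper_pipe_inj[OF assms] by (simp add: card_image)
  also have "\<dots> \<le> card {0..<int n}"
    using n_pos by (intro card_mono) auto
  finally show ?thesis by simp
qed

lemma proper_pipe_convex: "proper_pipe n le t \<Longrightarrow> poset_convex le t"
  and proper_pipe_connected: "proper_pipe n le t \<Longrightarrow> hasse_connected le t"
  and proper_pipe_nonempty: "proper_pipe n le t \<Longrightarrow> t \<noteq> {}"
  and proper_pipe_card: "proper_pipe n le t \<Longrightarrow> card t > 1"
  by (auto simp: proper_pipe_def pipe_def)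

lemma proper_pipe_shift_mem:
  assumes "proper_pipe n le t" "i \<in> t" "i + d * int n \<in> t"
  shows "d = 0"
proof -
  have "(i + d * int n) mod int n = i mod int n" by simp
  then have "i + d * int n = i"
    using inj_onD[OF proper_pipe_inj[OF assms(1)]] assms by blast
  then show ?thesis using n_pos by simp
qed

lemma proper_pipeI:
  assumes "poset_convex le t" "hasse_connected le t" "finite t" "card t > 1"
    and res: "\<And>i d. i \<in> t \<Longrightarrow> i + d * int n \<in> t \<Longrightarrow> d = 0"
  shows "proper_pipe n le t"
proof -
  have "inj_on (\<lambda>i. i mod int n) t"
  proof (rule inj_onI)
    fix i j assume ij: "i \<in> t" "j \<in> t" "i mod int n = j mod int n"
    moreover have "i div int n * int n + i mod int n = i" "j div int n * int n + j mod int n = j"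
      by simp_all
    ultimately have j: "j = i + (j div int n - i div int n) * int n"
      unfolding left_diff_distrib by linarith
    then have "j div int n - i div int n = 0" using res[of i] ij by metis
    then show "i = j" using j by simp
  qed
  then show ?thesis using assms by (auto simp: proper_pipe_def pipe_def)
qed

lemma proper_pipe_shift:
  assumes "proper_pipe n le t"
  shows "proper_pipe n le (shift d t)"
proof (rule proper_pipeI)
  have inj: "inj_on (\<lambda>i. i + d * int n) t" by (simp add: inj_on_def)
  show "finite (shift d t)" "card (shift d t) > 1"
    using proper_pipe_finite[OF assms] proper_pipe_card[OF assms] by (simp_all add: card_image inj)
  show conv: "poset_convex le (shift d t)"
    unfolding poset_convex_def
  proof clarify
    fix i j k assume "i \<in> t" "k \<in> t" "lt (i + d * int n) j" "lt j (k + d * int n)"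
    then have "j - d * int n \<in> t"
      using poset_convexD[OF proper_pipe_convex[OF assms], of i k "j - d * int n"]
        le_shift[of i d "j - d * int n"] le_shift[of "j - d * int n" d k]
      by (simp add: strict_def)
    then show "j \<in> shift d t" by (metis diff_add_cancel imageI)
  qed
  show "d' = 0" if "i \<in> shift d t" "i + d' * int n \<in> shift d t" for i d'
    using that proper_pipe_shift_mem[OF assms] by (auto simp: algebra_simps)
  have "(i + d * int n, j + d * int n) \<in> {(a, b). a \<in> shift d t \<and> b \<in> shift d t \<and> (le a b \<or> le b a)}\<^sup>*"
    if "i \<in> t" "j \<in> t" for i j
  proof -
    have "(i, j) \<in> {(a, b). a \<in> t \<and> b \<in> t \<and> (covers le a b \<or> covers le b a)}\<^sup>*"
      using that proper_pipe_connected[OF assms] by (auto simp: hasse_connected_def)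
    then show ?thesis
    proof induction
      case (step j k)
      then have "(j + d * int n, k + d * int n) \<in> {(a, b). a \<in> shift d t \<and> b \<in> shift d t \<and> (le a b \<or> le b a)}"
        by (auto simp: covers_def strict_def)
      then show ?case by (rule rtrancl_into_rtrancl[OF step.IH])
    qed simp
  qed
  then show "hasse_connected le (shift d t)"
    by (intro hasse_connectedI[OF conv]) blast
qed

text \<open>These two-element pipes turn nonnegative gap sums into monotonicity; the only covers
  they miss are those between congruent elements.\<close>

lemma proper_pipe_cover:
  assumes "covers le i j" "\<And>d. j \<noteq> i + d * int n"
  shows "proper_pipe n le {i, j}"
proof (rule proper_pipeI)
  have ij: "lt i j" using assms by (simp add: covers_def)
  show "poset_convex le {i, j}"
    unfolding poset_convex_def
  proof (intro allI impI)
    fix a b c assume "a \<in> {i, j} \<and> c \<in> {i, j} \<and> lt a b \<and> lt b c"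
    then have abc: "a \<in> {i, j}" "c \<in> {i, j}" "lt a b" "lt b c" "lt a c" using lt_trans by blast+
    moreover have "a = i" "c = j" using abc ij le_antisym by (auto simp: strict_def)
    ultimately show "b \<in> {i, j}" using assms(1) by (auto simp: covers_def)
  qed
  show "hasse_connected le {i, j}"
    using assms(1) unfolding hasse_connected_def by auto
  show "finite {i, j}" "card {i, j} > 1" using ij by (auto simp: strict_def)
  show "d = 0" if "k \<in> {i, j}" "k + d * int n \<in> {i, j}" for k d
    using that assms(2)[of d] assms(2)[of "- d"] n_pos by (auto simp: algebra_simps)
qed

lemma connected_exit:
  assumes "hasse_connected le t" "i \<in> t" "i \<in> s" "\<not> t \<subseteq> s"
  obtains a b where "a \<in> t" "b \<in> t" "a \<in> s" "b \<notin> s" "lt a b \<or> lt b a"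
proof -
  obtain j where j: "j \<in> t" "j \<notin> s" using assms by blast
  have "(i, j) \<in> {(a, b). a \<in> t \<and> b \<in> t \<and> (covers le a b \<or> covers le b a)}\<^sup>*"
    using assms j by (auto simp: hasse_connected_def)
  then have "j \<in> s \<or> (\<exists>a b. a \<in> t \<and> b \<in> t \<and> a \<in> s \<and> b \<notin> s \<and> (lt a b \<or> lt b a))"
  proof induction
    case (step y z)
    then show ?case by (auto simp: covers_def)
  qed (use assms in simp)
  then show thesis using j that by blast
qed

text \<open>A path needs no more steps than the relation has edges, at most n^2. The bound is crude,
  but only its dependence on n alone matters.\<close>

lemma connected_diam:
  fixes g :: "int \<Rightarrow> real"
  assumes "proper_pipe n le t" "i \<in> t" "j \<in> t" "D \<ge> 0"
    and D: "\<And>a b. a \<in> t \<Longrightarrow> b \<in> t \<Longrightarrow> lt a b \<Longrightarrow> \<bar>g a - g b\<bar> \<le> D"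
  shows "\<bar>g i - g j\<bar> \<le> real n ^ 2 * D"
proof -
  let ?H = "{(a, b). a \<in> t \<and> b \<in> t \<and> (covers le a b \<or> covers le b a)}"
  have sub: "?H \<subseteq> t \<times> t" by auto
  have fin: "finite t" using assms proper_pipe_finite by blast
  then have finH: "finite ?H" using sub finite_subset by blast
  have "card ?H \<le> card (t \<times> t)" using sub fin by (intro card_mono) auto
  also have "\<dots> \<le> n * n"
    using proper_pipe_card_le[OF assms(1)] by (simp add: card_cartesian_product mult_le_mono)
  finally have card: "card ?H \<le> n * n" .
  have "(i, j) \<in> ?H\<^sup>*" using assms proper_pipe_connected by (auto simp: hasse_connected_def)
  then obtain k where k: "k \<le> card ?H" "(i, j) \<in> ?H ^^ k"
    using rtrancl_finite_eq_relpow[OF finH] by auto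
  have "\<bar>g i - g j\<bar> \<le> real k * D" using k(2)
  proof (induction k arbitrary: j)
    case (Suc k)
    then obtain y where y: "(i, y) \<in> ?H ^^ k" "(y, j) \<in> ?H" by auto
    then have "\<bar>g y - g j\<bar> \<le> D" using D[of y j] D[of j y] by (auto simp: covers_def)
    then show ?case using Suc.IH[OF y(1)] by (simp add: algebra_simps)
  qed simp
  also have "\<dots> \<le> real n ^ 2 * D"
  proof (rule mult_right_mono)
    show "real k \<le> real n ^ 2" using k(1) card by (simp add: power2_eq_square flip: of_nat_mult)
  qed (rule \<open>D \<ge> 0\<close>)
  finally show ?thesis .
qed

section \<open>Pipings and linear extensions\<close>

lemma shift_shift: "shift d (shift d' t) = shift (d + d') t"
  by (auto simp: image_image algebra_simps)

lemma proper_pipingI: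
  assumes "\<And>t. t \<in> T \<Longrightarrow> proper_pipe n le t" "\<And>t d. t \<in> T \<Longrightarrow> shift d t \<in> T"
    "\<And>s t. s \<in> T \<Longrightarrow> t \<in> T \<Longrightarrow> s \<subseteq> t \<or> t \<subseteq> s \<or> s \<inter> t = {}" "acyclic (piping_digraph le T)"
  shows "proper_piping n le T"
proof -
  have "T = \<Union> (pipe_class n ` T)"
  proof
    have "t \<in> pipe_class n t" for t
      unfolding pipe_class_def by (auto intro!: exI[of _ 0])
    then show "T \<subseteq> \<Union> (pipe_class n ` T)" by blast
    show "\<Union> (pipe_class n ` T) \<subseteq> T" using assms(2) by (auto simp: pipe_class_def)
  qed
  then have "periodic_pipes n le T"
    unfolding periodic_pipes_def using assms(1) unfolding proper_pipe_def
    by (intro exI[of _ "pipe_class n ` T"] conjI image_mono subsetI CollectI) auto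
  then show ?thesis using assms by (simp add: proper_piping_def piping_def)
qed

lemma piping_pipe: "proper_piping n le T \<Longrightarrow> t \<in> T \<Longrightarrow> proper_pipe n le t"
  by (simp add: proper_piping_def)

lemma piping_nested:
  "proper_piping n le T \<Longrightarrow> s \<in> T \<Longrightarrow> t \<in> T \<Longrightarrow> i \<in> s \<Longrightarrow> i \<in> t \<Longrightarrow> s \<subseteq> t \<or> t \<subseteq> s"
  unfolding proper_piping_def piping_def by blast

lemma piping_acyclic: "proper_piping n le T \<Longrightarrow> acyclic (piping_digraph le T)"
  by (simp add: proper_piping_def piping_def)

lemma piping_shift:
  assumes "proper_piping n le T" "t \<in> T"
  shows "shift d t \<in> T"
proof -
  obtain E where E: "E \<subseteq> pipe_class n ` {t. pipe n le t}" "T = \<Union> E"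
    using assms by (auto simp: proper_piping_def piping_def periodic_pipes_def)
  then obtain u where u: "t \<in> pipe_class n u" "pipe_class n u \<in> E" using assms by blast
  then have "shift d t \<in> pipe_class n u"
    unfolding pipe_class_def mem_Collect_eq by (metis shift_shift)
  then show ?thesis using u E by blast
qed

lemma proper_piping_subset:
  assumes "proper_piping n le T" "T' \<subseteq> T" "\<And>t d. t \<in> T' \<Longrightarrow> shift d t \<in> T'"
  shows "proper_piping n le T'"
proof (rule proper_pipingI)
  have "piping_digraph le T' \<subseteq> piping_digraph le T"
    using assms(2) by (auto simp: piping_digraph_def)
  then show "acyclic (piping_digraph le T')"
    using piping_acyclic[OF assms(1)] acyclic_subset by blast
  show "s \<subseteq> t \<or> t \<subseteq> s \<or> s \<inter> t = {}" if "s \<in> T'" "t \<in> T'" for s t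
    using piping_nested[OF assms(1)] that assms(2) by blast
qed (use assms piping_pipe in blast)+

lemma piping_maximal:
  assumes "proper_piping n le T" "s \<in> T"
  obtains m where "m \<in> T" "s \<subseteq> m" "\<And>t. t \<in> T \<Longrightarrow> m \<subseteq> t \<Longrightarrow> m = t"
proof -
  have "\<exists>m. (m \<in> T \<and> s \<subseteq> m) \<and> (\<forall>t. t \<in> T \<and> s \<subseteq> t \<longrightarrow> card t \<le> card m)"
    using assms proper_pipe_card_le[OF piping_pipe[OF assms(1)]]
    by (intro ex_has_greatest_nat[of _ s _ "Suc n"]) (auto simp: less_Suc_eq_le)
  then obtain m where m: "m \<in> T" "s \<subseteq> m" "\<And>t. t \<in> T \<Longrightarrow> s \<subseteq> t \<Longrightarrow> card t \<le> card m"
    by blast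
  have "m = t" if "t \<in> T" "m \<subseteq> t" for t
    using that m proper_pipe_finite[OF piping_pipe[OF assms(1) \<open>t \<in> T\<close>]]
    by (meson card_seteq order_trans)
  then show thesis using m that by blast
qed

text \<open>Models a linear extension after contraction of the tubes: strictness is required only
  where no common tube forces equality. Values are integers so that distinct heights differ by at
  least 1.\<close>

definition is_height :: "int set set \<Rightarrow> (int \<Rightarrow> int) \<Rightarrow> bool" where
  "is_height T h \<longleftrightarrow> (\<forall>i d. h (i + d * int n) = h i + d * int n) \<and>
    (\<forall>i j. le i j \<longrightarrow> h i \<le> h j) \<and>
    (\<forall>s\<in>T. \<forall>i\<in>s. \<forall>j\<in>s. h i = h j) \<and>
    (\<forall>i j. lt i j \<and> (\<forall>s\<in>T. i \<in> s \<longrightarrow> j \<notin> s) \<longrightarrow> h i < h j)"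

text \<open>The preorder \<open>pre\<close> identifies the elements of each tube. Acyclicity makes it antisymmetric
  up to this identification, so counting lower sets gives a periodic strict linear extension.\<close>

lemma piping_height_exists:
  assumes T: "proper_piping n le T"
  shows "\<exists>h. is_height T h"
proof -
  define M where "M = {s \<in> T. \<forall>t\<in>T. s \<subseteq> t \<longrightarrow> s = t}"
  define G where "G = piping_digraph le T"
  define pre where "pre i j \<longleftrightarrow> (i, j) \<in> {(i, j). le i j \<or> (\<exists>s\<in>T. i \<in> s \<and> j \<in> s)}\<^sup>*" for i j
  \<comment> \<open>Normal form of a path of \<open>pre\<close> that is not a plain inequality: rise
    into a maximal tube, follow edges of the digraph, rise out of a maximal tube. In this form
    acyclicity applies.\<close>
  define via where "via i j \<longleftrightarrow>
    (\<exists>s\<in>M. \<exists>s'\<in>M. (s, s') \<in> G\<^sup>* \<and> (\<exists>a\<in>s. le i a) \<and> (\<exists>b\<in>s'. le b j))" for i j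
  have MT: "M \<subseteq> T" by (auto simp: M_def)
  have conv: "poset_convex le s" if "s \<in> T" for s
    using T piping_pipe proper_pipe_convex that by blast
  have pre_trans: "pre i j \<Longrightarrow> pre j k \<Longrightarrow> pre i k" for i j k
    unfolding pre_def by (rule rtrancl_trans)
  have pre_le: "pre i j" if "le i j" for i j
    unfolding pre_def using that by (intro r_into_rtrancl) auto
  have pre_tube: "pre i j" if "s \<in> T" "i \<in> s" "j \<in> s" for i j s
    unfolding pre_def using that by (intro r_into_rtrancl) auto
  have link: "(s, s') \<in> G\<^sup>*" if "s \<in> M" "s' \<in> M" "b \<in> s" "c \<in> s'" "le b c" for s s' b c
  proof (cases "s = s'")
    case False
    then have "s \<inter> s' = {}"
      using piping_nested[OF T, of s s'] that unfolding M_def by blast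
    then have "(s, s') \<in> G"
      using that MT unfolding G_def piping_digraph_def strict_def by blast
    then show ?thesis by blast
  qed simp
  have antiG: "s = s'" if "(s, s') \<in> G\<^sup>*" "(s', s) \<in> G\<^sup>*" for s s'
    using acyclic_impl_antisym_rtrancl[OF piping_acyclic[OF T]] that
    unfolding G_def by (auto dest: antisymD)
  have pre_via: "le i j \<or> via i j" if "pre i j" for i j
    using that unfolding pre_def
  proof induction
    case (step j k)
    show ?case
    proof (cases "le j k")
      case True
      have "le i k" if "le i j" using that True by (rule le_trans)
      moreover have "\<exists>b\<in>s'. le b k" if "\<exists>b\<in>s'. le b j" for s'
        using that True le_trans by blast
      ultimately show ?thesis using step.IH unfolding via_def by metis
    next
      case False
      then obtain t where t: "t \<in> T" "j \<in> t" "k \<in> t" using step.hyps by auto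
      obtain m where "m \<in> T" "t \<subseteq> m" "\<And>t. t \<in> T \<Longrightarrow> m \<subseteq> t \<Longrightarrow> m = t"
        using piping_maximal[OF T t(1)] by metis
      then have m: "m \<in> M" "j \<in> m" "k \<in> m" using t by (auto simp: M_def)
      from step.IH show ?thesis
      proof
        assume "le i j"
        then show ?thesis using m unfolding via_def by (meson rtrancl.rtrancl_refl le_refl)
      next
        assume "via i j"
        then obtain s s' b where "s \<in> M" "s' \<in> M" "(s, s') \<in> G\<^sup>*" "\<exists>a\<in>s. le i a" "b \<in> s'" "le b j"
          unfolding via_def by blast
        moreover from this have "(s, m) \<in> G\<^sup>*" using link[of s' m b j] m by (meson rtrancl_trans)
        ultimately show ?thesis using m le_refl[of k] unfolding via_def by meson
      qed
    qed
  qed simp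
  \<comment> \<open>Here and in \<open>anti\<close>, opposite paths involving tubes close up to a
    cycle of maximal tubes. Antisymmetry of \<open>G\<^sup>*\<close> merges these tubes, and
    convexity puts \<open>i\<close> and \<open>j\<close> into the common one.\<close>
  have le_via: "\<exists>s\<in>T. i \<in> s \<and> j \<in> s" if ij: "le i j" "via j i" for i j
  proof -
    obtain s s' a b where s: "s \<in> M" "s' \<in> M" "(s, s') \<in> G\<^sup>*" "a \<in> s" "le j a" "b \<in> s'" "le b i"
      using ij(2) unfolding via_def by blast
    then have "(s', s) \<in> G\<^sup>*" using link[of s' s b a] le_trans[of b i a] le_trans[of i j a] ij by simp
    then have "s = s'" using antiG s by blast
    then have "i \<in> s" "j \<in> s"
      using s ij le_trans[of b i j] le_trans[of i j a] poset_convexD[OF conv, of s b a] MT by auto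
    then show ?thesis using s MT by blast
  qed
  have anti: "i = j \<or> (\<exists>s\<in>T. i \<in> s \<and> j \<in> s)" if "pre i j" "pre j i" for i j
    using pre_via[OF that(1)] pre_via[OF that(2)]
  proof (elim disjE)
    assume "via i j" "via j i"
    then obtain s s' a b r r' c d where *: "s \<in> M" "s' \<in> M" "(s, s') \<in> G\<^sup>*" "a \<in> s" "le i a" "b \<in> s'" "le b j"
      "r \<in> M" "r' \<in> M" "(r, r') \<in> G\<^sup>*" "c \<in> r" "le j c" "d \<in> r'" "le d i"
      unfolding via_def by blast
    then have "(s', r) \<in> G\<^sup>*" "(r', s) \<in> G\<^sup>*"
      using link[of s' r b c] link[of r' s d a] le_trans[of b j c] le_trans[of d i a] by simp_all
    then have "(s, r) \<in> G\<^sup>*" "(r, s) \<in> G\<^sup>*" "(s', s) \<in> G\<^sup>*" "(s, r') \<in> G\<^sup>*"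
      using * by (blast intro: rtrancl_trans)+
    then have "s = s'" "s = r" "s = r'" using \<open>(r', s) \<in> G\<^sup>*\<close> * antiG by blast+
    then have "i \<in> s" "j \<in> s"
      using * poset_convexD[OF conv, of s d a] poset_convexD[OF conv, of s b c] MT by auto
    then show ?thesis using * MT by blast
  qed (use le_via le_antisym in blast)+
  have pre_shift: "pre (i + d * int n) (j + d * int n)" if "pre i j" for i j d
    using that unfolding pre_def
  proof induction
    case (step j k)
    have "le (j + d * int n) (k + d * int n) \<or> (\<exists>s\<in>T. j + d * int n \<in> s \<and> k + d * int n \<in> s)"
    proof (cases "le j k")
      case False
      then obtain s where "s \<in> T" "j \<in> s" "k \<in> s" using step.hyps(2) by auto
      then show ?thesis using piping_shift[OF T, of s d] by (intro disjI2 bexI[of _ "shift d s"]) simp_all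
    qed simp
    then have "(j + d * int n, k + d * int n) \<in> {(i, j). le i j \<or> (\<exists>s\<in>T. i \<in> s \<and> j \<in> s)}" by blast
    then show ?case by (rule rtrancl_into_rtrancl[OF step.IH])
  qed simp
  \<comment> \<open>The lower set of \<open>i\<close> is infinite, but it has a last element in each
    residue class. Otherwise \<open>i + n\<close> would lie below \<open>i\<close>, and the two
    would share a tube, which contains no two congruent elements.\<close>
  have "\<exists>m. \<forall>k. pre (r + k * int n) i \<longleftrightarrow> k \<le> m" for r i
  proof -
    obtain c where c: "c \<ge> 0" "\<And>i j. i + c \<le> j \<Longrightarrow> le i j"
      using far_le by blast
    let ?S = "{k. pre (r + k * int n) i}"
    have down: "k \<in> ?S" if "k' \<in> ?S" "k \<le> k'" for k k'
    proof -
      have "le (r + k * int n) (r + k' * int n)"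
        using le_add_mult[of "k' - k" "r + k * int n"] that by (simp add: algebra_simps)
      then show ?thesis using pre_trans[OF pre_le] that by blast
    qed
    define k0 where "k0 = (i - c - r) div int n"
    have "k0 * int n \<le> i - c - r"
    proof -
      have "(i - c - r) mod int n \<ge> 0" using n_pos by simp
      moreover have "k0 * int n + (i - c - r) mod int n = i - c - r" by (simp add: k0_def)
      ultimately show ?thesis by linarith
    qed
    then have k0: "k0 \<in> ?S" using c(2) pre_le by auto
    have bdd: "k \<le> \<bar>i + int n + c - r\<bar>" if "k \<in> ?S" for k
    proof (rule ccontr)
      assume "\<not> ?thesis"
      then have "k > \<bar>i + int n + c - r\<bar>" by simp
      moreover from this have "k * 1 \<le> k * int n"
        using n_pos by (intro mult_left_mono) auto
      ultimately have "le (i + 1 * int n) (r + k * int n)" by (intro c(2)) auto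
      then have "pre (i + 1 * int n) i" using that pre_le pre_trans by blast
      moreover have "pre i (i + 1 * int n)" using pre_le le_add_mult[of 1] by simp
      moreover have "i + 1 * int n \<noteq> i" using n_pos by simp
      ultimately obtain s where "s \<in> T" "i \<in> s" "i + 1 * int n \<in> s"
        using anti by blast
      then show False using proper_pipe_shift_mem[OF piping_pipe[OF T], of s i 1] by simp
    qed
    let ?F = "{k \<in> ?S. k0 \<le> k}"
    have "?F \<subseteq> {k0..\<bar>i + int n + c - r\<bar>}" using bdd by auto
    then have fin: "finite ?F" using finite_subset by blast
    then have "Max ?F \<in> ?F" using k0 by (intro Max_in) auto
    moreover have "k \<le> Max ?F" if "k \<in> ?S" for k
    proof (cases "k0 \<le> k")
      case True
      then show ?thesis using fin that by (intro Max_ge) auto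
    next
      case False
      moreover have "k0 \<le> Max ?F" using \<open>Max ?F \<in> ?F\<close> by blast
      ultimately show ?thesis by linarith
    qed
    ultimately have "pre (r + k * int n) i \<longleftrightarrow> k \<le> Max ?F" for k
      using down by blast
    then show ?thesis by blast
  qed
  then obtain \<kappa> where \<kappa>: "\<And>r i k. pre (r + k * int n) i \<longleftrightarrow> k \<le> \<kappa> r i" by metis
  \<comment> \<open>A regularized count of the lower set of \<open>i\<close>: each residue class
    contributes the position of its last element, so translation by \<open>d * n\<close> adds
    \<open>d\<close> to each of n summands.\<close>
  define h where "h i = (\<Sum>r\<in>{0..<int n}. \<kappa> r i)" for i
  have \<kappa>_mono: "\<kappa> r i \<le> \<kappa> r j" if "pre i j" for r i j
    using \<kappa>[of r "\<kappa> r i"] that pre_trans by blast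
  have h_mono: "h i \<le> h j" if "pre i j" for i j
    unfolding h_def using \<kappa>_mono[OF that] by (intro sum_mono)
  have h1: "h (i + d * int n) = h i + d * int n" for i d
  proof -
    have "k \<le> \<kappa> r (i + d * int n) \<longleftrightarrow> k \<le> \<kappa> r i + d" for r k
    proof -
      have "k \<le> \<kappa> r (i + d * int n) \<longleftrightarrow> pre (r + k * int n) (i + d * int n)" by (simp add: \<kappa>)
      also have "\<dots> \<longleftrightarrow> pre (r + (k - d) * int n) i"
        using pre_shift[of "r + (k - d) * int n" i d] pre_shift[of "r + k * int n" "i + d * int n" "- d"]
        by (auto simp: algebra_simps)
      finally show ?thesis by (auto simp: \<kappa>)
    qed
    then have "\<kappa> r (i + d * int n) = \<kappa> r i + d" for r by (intro order_antisym) blast+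
    then show ?thesis by (simp add: h_def sum.distrib)
  qed
  have h2: "h i < h j" if ij: "lt i j" "\<forall>s\<in>T. i \<in> s \<longrightarrow> j \<notin> s" for i j
  proof -
    have "pre i j" using ij by (intro pre_le) (simp add: strict_def)
    moreover have "\<not> pre j i" using ij anti[of i j] \<open>pre i j\<close> by (auto simp: strict_def)
    \<comment> \<open>The residue class of \<open>j\<close> itself witnesses strictness:
      \<open>j\<close> belongs to its own lower set but not to that of \<open>i\<close>.\<close>
    then have "\<not> j div int n \<le> \<kappa> (j mod int n) i" by (simp flip: \<kappa>)
    moreover have "pre j j" by (simp add: pre_le)
    then have "j div int n \<le> \<kappa> (j mod int n) j" by (simp flip: \<kappa>)
    ultimately show ?thesis unfolding h_def using \<kappa>_mono n_pos
      by (intro sum_strict_mono_ex1) (auto intro!: bexI[of _ "j mod int n"])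
  qed
  have h3: "h i = h j" if "s \<in> T" "i \<in> s" "j \<in> s" for s i j
    using that by (intro order_antisym h_mono pre_tube)
  have h4: "h i \<le> h j" if "le i j" for i j
    using that by (intro h_mono pre_le)
  show ?thesis
    unfolding is_height_def
  proof (intro exI[of _ h] conjI allI ballI impI)
    show "h i = h j" if "s \<in> T" "i \<in> s" "j \<in> s" for s i j
      using that by (rule h3)
    show "h i < h j" if "lt i j \<and> (\<forall>s\<in>T. i \<in> s \<longrightarrow> j \<notin> s)" for i j
      using that by (intro h2) simp_all
  qed (rule h1, rule h4)
qed

section \<open>Active pipes\<close>

definition pairs :: "int set \<Rightarrow> (int \<times> int) set" where
  "pairs t = {(i, j). i \<in> t \<and> j \<in> t \<and> lt i j}"

definition gap_sum :: "int set \<Rightarrow> (int \<Rightarrow> real) \<Rightarrow> real" where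
  "gap_sum t x = (\<Sum>(i, j)\<in>pairs t. x j - x i)"

text \<open>Kept general in \<open>L\<close>: feasible points share one positive value, and their
  differences have \<open>L = 0\<close>.\<close>

definition quasi_periodic :: "real \<Rightarrow> (int \<Rightarrow> real) \<Rightarrow> bool" where
  "quasi_periodic L x \<longleftrightarrow> (\<forall>i d. x (i + d * int n) = x i + of_int d * L)"

definition feasible :: "real \<Rightarrow> (int \<Rightarrow> real) \<Rightarrow> bool" where
  "feasible M x \<longleftrightarrow> quasi_periodic (real n * M ^ Suc n) x \<and>
     (\<forall>t. proper_pipe n le t \<longrightarrow> M ^ card t \<le> gap_sum t x)"

definition active :: "real \<Rightarrow> (int \<Rightarrow> real) \<Rightarrow> int set set" where
  "active M x = {t. proper_pipe n le t \<and> gap_sum t x = M ^ card t}"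

lemma finite_pairs: "finite t \<Longrightarrow> finite (pairs t)"
  by (rule finite_subset[of _ "t \<times> t"]) (auto simp: pairs_def)

lemma card_pairs:
  assumes "proper_pipe n le t"
  shows "card (pairs t) \<le> n * n"
proof -
  have "card (pairs t) \<le> card (t \<times> t)"
    using proper_pipe_finite[OF assms] by (intro card_mono) (auto simp: pairs_def)
  also have "\<dots> \<le> n * n"
    using proper_pipe_card_le[OF assms] by (simp add: card_cartesian_product mult_le_mono)
  finally show ?thesis .
qed

lemma gap_sum_cong:
  "(\<And>i j. i \<in> t \<Longrightarrow> j \<in> t \<Longrightarrow> x j - x i = y j - y i) \<Longrightarrow> gap_sum t x = gap_sum t y"
  unfolding gap_sum_def by (intro sum.cong) (auto simp: pairs_def)

lemma gap_sum_shift: "gap_sum (shift d t) x = gap_sum t (\<lambda>i. x (i + d * int n))"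
proof -
  let ?f = "\<lambda>(i, j). (i + d * int n, j + d * int n)"
  have eq: "pairs (shift d t) = ?f ` pairs t"
    by (auto simp: pairs_def image_iff)
  have inj: "inj_on ?f (pairs t)" by (auto simp: inj_on_def)
  show ?thesis
    unfolding gap_sum_def by (rule sum.reindex_cong[OF inj eq]) auto
qed

lemma gap_sum_shift_quasi:
  "quasi_periodic L x \<Longrightarrow> gap_sum (shift d t) x = gap_sum t x"
  unfolding gap_sum_shift by (rule gap_sum_cong) (simp add: quasi_periodic_def)

lemma gap_sum_affine:
  "gap_sum t (\<lambda>i. c * x i + y i) = c * gap_sum t x + gap_sum t y"
  by (simp add: gap_sum_def sum_distrib_left case_prod_unfold sum.distrib[symmetric] algebra_simps)

lemma gap_sum_le:
  assumes "proper_pipe n le t" "D \<ge> 0" "\<And>i j. i \<in> t \<Longrightarrow> j \<in> t \<Longrightarrow> x j - x i \<le> D"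
  shows "gap_sum t x \<le> real n ^ 2 * D"
proof -
  have "gap_sum t x \<le> real (card (pairs t)) * D"
    unfolding gap_sum_def using assms(3) by (intro sum_bounded_above) (auto simp: pairs_def)
  also have "\<dots> \<le> real (n * n) * D"
    using card_pairs[OF assms(1)] assms(2) by (intro mult_right_mono) (simp_all del: of_nat_mult)
  finally show ?thesis by (simp add: power2_eq_square)
qed

lemma gap_le_gap_sum:
  assumes "finite t" "\<And>i j. le i j \<Longrightarrow> x i \<le> x j" "i \<in> t" "j \<in> t" "lt i j"
  shows "x j - x i \<le> gap_sum t x"
proof -
  have "(\<Sum>(i, j)\<in>{(i, j)}. x j - x i) \<le> (\<Sum>(i, j)\<in>pairs t. x j - x i)"
    using assms by (intro sum_mono2 finite_pairs) (auto simp: pairs_def strict_def)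
  then show ?thesis by (simp add: gap_sum_def)
qed

text \<open>A cover of non-congruent elements is a pipe whose gap sum is a single difference; a
  cover of congruent elements is handled by \<open>L \<ge> 0\<close>. Cover chains give the rest.
  The case \<open>L = 0\<close> later controls recession directions.\<close>

lemma gap_sum_nonneg_mono:
  assumes x: "quasi_periodic L x" "L \<ge> 0" and nonneg: "\<And>t. proper_pipe n le t \<Longrightarrow> gap_sum t x \<ge> 0"
    and "le i j"
  shows "x i \<le> x j"
proof -
  have cover: "x p \<le> x q" if pq: "covers le p q" for p q
  proof (cases "\<exists>d. q = p + d * int n")
    case True
    then obtain d where d: "q = p + d * int n" by blast
    have "d \<ge> 0"
    proof (rule ccontr)
      assume "\<not> d \<ge> 0"
      then have "le q p" using le_add_mult[of "- d" q] d by simp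
      then show False using pq le_antisym by (auto simp: covers_def strict_def)
    qed
    then show ?thesis using x d by (simp add: quasi_periodic_def)
  next
    case False
    have "pairs {p, q} = {(p, q)}"
      using pq le_antisym by (auto simp: pairs_def covers_def strict_def)
    then have "gap_sum {p, q} x = x q - x p" by (simp add: gap_sum_def)
    then show ?thesis using nonneg[OF proper_pipe_cover[OF pq]] False by auto
  qed
  show ?thesis
    using covers_chain[OF \<open>le i j\<close>]
  proof induction
    case (step p q)
    then show ?case using cover[of p q] by auto
  qed simp
qed

lemma feasible_quasi: "feasible M x \<Longrightarrow> quasi_periodic (real n * M ^ Suc n) x"
  by (simp add: feasible_def)

lemma feasible_mono:
  assumes "feasible M x" "M > 0" "le i j"
  shows "x i \<le> x j"
proof (rule gap_sum_nonneg_mono)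
  show "gap_sum t x \<ge> 0" if "proper_pipe n le t" for t
    using assms that unfolding feasible_def by (meson order_trans zero_le_power less_imp_le)
qed (use assms in \<open>auto simp: feasible_def\<close>)

text \<open>The pipe is the order-convex hull of \<open>s \<union> t\<close>. Monotonicity keeps its
  values in the range spanned by \<open>s \<union> t\<close>; as this range is shorter than the
  period constant, the hull contains no two congruent elements.\<close>

lemma pipe_join:
  assumes s: "proper_pipe n le s" "i0 \<in> s" and t: "proper_pipe n le t" "j0 \<in> t" and "le i0 j0"
    and x: "quasi_periodic L x" "\<And>i j. le i j \<Longrightarrow> x i \<le> x j" "D < L"
    and D: "\<And>a b. a \<in> s \<union> t \<Longrightarrow> b \<in> s \<union> t \<Longrightarrow> x b - x a \<le> D"
  shows "\<exists>r. proper_pipe n le r \<and> s \<union> t \<subseteq> r \<and> gap_sum r x \<le> real n ^ 2 * D"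
proof -
  define r where "r = {k. \<exists>i\<in>s \<union> t. \<exists>j\<in>s \<union> t. le i k \<and> le k j}"
  let ?R = "{(a, b). a \<in> r \<and> b \<in> r \<and> (le a b \<or> le b a)}"
  have sub: "s \<union> t \<subseteq> r" unfolding r_def using le_refl by blast
  have spread: "x b - x a \<le> D" if ab: "a \<in> r" "b \<in> r" for a b
  proof -
    obtain i j where "i \<in> s \<union> t" "le i a" "j \<in> s \<union> t" "le b j"
      using ab unfolding r_def by blast
    then show ?thesis using D[of i j] x(2)[of i a] x(2)[of b j] by linarith
  qed
  have "r = (\<Union>i\<in>s \<union> t. \<Union>j\<in>s \<union> t. {k. le i k \<and> le k j})" by (auto simp: r_def)
  then have fin: "finite r"
    using finite_interval proper_pipe_finite s t by simp
  have conv: "poset_convex le r"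
    unfolding poset_convex_def
  proof (intro allI impI)
    fix i j k assume ijk: "i \<in> r \<and> k \<in> r \<and> lt i j \<and> lt j k"
    then obtain a b where "a \<in> s \<union> t" "le a i" "b \<in> s \<union> t" "le k b"
      unfolding r_def by blast
    then show "j \<in> r"
      using ijk le_trans[of a i j] le_trans[of j k b] unfolding r_def strict_def by blast
  qed
  have symR: "sym (?R\<^sup>*)" by (intro sym_rtrancl) (auto simp: sym_def)
  have inner: "(i, j) \<in> ?R\<^sup>*" if u: "proper_pipe n le u" "u \<subseteq> r" "i \<in> u" "j \<in> u" for i j u
  proof -
    have "{(a, b). a \<in> u \<and> b \<in> u \<and> (covers le a b \<or> covers le b a)} \<subseteq> ?R"
      using u by (auto simp: covers_def strict_def)
    then show ?thesis
      using proper_pipe_connected[OF u(1)] u rtrancl_mono unfolding hasse_connected_def by blast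
  qed
  have "(i0, j0) \<in> ?R\<^sup>*" using sub s t \<open>le i0 j0\<close> by (intro r_into_rtrancl) auto
  moreover have "(i0, j) \<in> ?R\<^sup>*" if "j \<in> s" for j using inner[of s i0 j] that s sub by simp
  moreover have "(j0, j) \<in> ?R\<^sup>*" if "j \<in> t" for j using inner[of t j0 j] that t sub by simp
  ultimately have base: "(i0, j) \<in> ?R\<^sup>*" if "j \<in> s \<union> t" for j
    using that rtrancl_trans[of i0 j0 ?R j] by blast
  have all: "(i0, k) \<in> ?R\<^sup>*" if k: "k \<in> r" for k
  proof -
    obtain i where i: "i \<in> s \<union> t" "le i k" using k unfolding r_def by blast
    then have "(i, k) \<in> ?R" using k sub by auto
    then show ?thesis using base[OF i(1)] by (rule rtrancl_into_rtrancl[rotated])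
  qed
  have "hasse_connected le r"
    using all symR by (intro hasse_connectedI[OF conv]) (meson rtrancl_trans symD)
  moreover have "card r > 1"
    using card_mono[OF fin, of s] sub proper_pipe_card[OF s(1)] by simp
  moreover have "d = 0" if "i \<in> r" "i + d * int n \<in> r" for i d
  proof (rule ccontr)
    assume "d \<noteq> 0"
    have "x i - x i \<le> D" using spread that by blast
    then have L: "L > 0" using x(3) by simp
    have xd: "x (i + d * int n) = x i + of_int d * L" using x(1) by (simp add: quasi_periodic_def)
    have "\<bar>of_int d * L\<bar> \<le> D"
      using spread[OF that] spread[OF that(2,1)] unfolding xd by (simp add: abs_le_iff)
    moreover have "1 * L \<le> \<bar>of_int d\<bar> * L"
      using \<open>d \<noteq> 0\<close> L by (intro mult_right_mono) auto
    ultimately show False using x(3) L by (simp add: abs_mult)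
  qed
  ultimately have r: "proper_pipe n le r"
    using conv fin by (intro proper_pipeI) auto
  have "D \<ge> 0" using spread[of i0 i0] s sub by auto
  then have "gap_sum r x \<le> real n ^ 2 * D" using gap_sum_le[OF r] spread by blast
  then show ?thesis using r sub by blast
qed

text \<open>Pigeonhole: the \<open>n\<close> consecutive windows of length \<open>\<delta>\<close> above \<open>x lo\<close> can only be hit by
  the \<open>n - 1\<close> residue classes other than that of \<open>lo\<close>.\<close>

lemma empty_window:
  assumes x: "quasi_periodic L x" and \<delta>: "\<delta> > 0" "real n * \<delta> < L"
  shows "\<exists>c. x lo \<le> c \<and> c + \<delta> \<le> x lo + real n * \<delta> \<and> (\<forall>i. x i \<le> c \<or> c + \<delta> < x i)"
proof (rule ccontr)
  assume neg: "\<not> ?thesis"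
  have "\<exists>i. x lo + real k * \<delta> < x i \<and> x i \<le> x lo + real k * \<delta> + \<delta>" if "k < n" for k
  proof -
    have "real (Suc k) * \<delta> \<le> real n * \<delta>" using that \<delta> by (intro mult_right_mono) auto
    then have "x lo + real k * \<delta> + \<delta> \<le> x lo + real n * \<delta>" by (simp add: algebra_simps)
    moreover have "x lo \<le> x lo + real k * \<delta>" using \<delta> by simp
    ultimately show ?thesis using neg by (meson not_less)
  qed
  then obtain f where f: "\<And>k. k < n \<Longrightarrow> x lo + real k * \<delta> < x (f k) \<and> x (f k) \<le> x lo + real k * \<delta> + \<delta>"
    by metis
  have f': "x lo < x (f k)" "x (f k) \<le> x lo + real n * \<delta>" if "k < n" for k
  proof -
    have "real (Suc k) * \<delta> \<le> real n * \<delta>" using that \<delta> by (intro mult_right_mono) auto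
    then show "x (f k) \<le> x lo + real n * \<delta>" using f[OF that] by (simp add: algebra_simps)
    have "0 \<le> real k * \<delta>" using \<delta> by simp
    then show "x lo < x (f k)" using f[OF that] by linarith
  qed
  have cong: "i = j" if "i mod int n = j mod int n" "\<bar>x i - x j\<bar> < L" for i j
  proof -
    have "i div int n * int n + i mod int n = i" "j div int n * int n + j mod int n = j" by simp_all
    then have j: "j = i + (j div int n - i div int n) * int n"
      using that unfolding left_diff_distrib by linarith
    define d where "d = j div int n - i div int n"
    have L: "L > 0" using that by linarith
    have "x j = x i + of_int d * L" using x j by (metis d_def quasi_periodic_def)
    then have "\<bar>of_int d\<bar> * L < 1 * L" using that L by (simp add: abs_mult)
    then have "\<bar>of_int d\<bar> < (1::real)" using L by (simp only: mult_less_cancel_right)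
    then have "d = 0" by linarith
    then show ?thesis using j d_def by simp
  qed
  let ?g = "\<lambda>k. f k mod int n"
  have "inj_on ?g {..<n}"
  proof (rule inj_onI)
    fix k l assume kl: "k \<in> {..<n}" "l \<in> {..<n}" "?g k = ?g l"
    then have "k < n" "l < n" by simp_all
    then have "\<bar>x (f k) - x (f l)\<bar> < L"
      using f'[of k] f'[of l] \<delta> by linarith
    then have "f k = f l" using cong[OF kl(3)] by blast
    then have "x (f k) = x (f l)" by simp
    then have "real k * \<delta> < real l * \<delta> + \<delta>" "real l * \<delta> < real k * \<delta> + \<delta>"
      using f[OF \<open>k < n\<close>] f[OF \<open>l < n\<close>] by linarith+
    then have "real k * \<delta> < (real l + 1) * \<delta>" "real l * \<delta> < (real k + 1) * \<delta>"
      by (simp_all add: algebra_simps)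
    then have "real k < real l + 1" "real l < real k + 1"
      using \<delta> by (simp_all only: mult_less_cancel_right)
    then show "k = l" by linarith
  qed
  moreover have "?g ` {..<n} \<subseteq> {0..<int n} - {lo mod int n}"
  proof clarify
    fix k assume "k < n"
    moreover have "?g k \<noteq> lo mod int n"
    proof
      assume "?g k = lo mod int n"
      moreover have "\<bar>x (f k) - x lo\<bar> < L" using f'[OF \<open>k < n\<close>] \<delta> by linarith
      ultimately have "f k = lo" by (rule cong)
      then show False using f'[OF \<open>k < n\<close>] by simp
    qed
    ultimately show "?g k \<in> {0..<int n} - {lo mod int n}" using n_pos by auto
  qed
  ultimately have "card {..<n} \<le> card ({0..<int n} - {lo mod int n})"
    by (intro card_inj_on_le) auto
  also have "\<dots> = n - 1" using n_pos by (subst card_Diff_singleton) auto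
  finally show False using n_pos by simp
qed

text \<open>All summands of a gap sum are nonnegative at a feasible point, so none exceeds the
  total.\<close>

lemma active_step:
  assumes "feasible M x" "M > 0" "t \<in> active M x" "a \<in> t" "b \<in> t" "lt a b"
  shows "\<bar>x a - x b\<bar> \<le> M ^ card t"
  using gap_le_gap_sum[of t x a b] feasible_mono[OF assms(1,2)] assms proper_pipe_finite[of t]
  by (auto simp: active_def strict_def)

text \<open>Let \<delta> be the larger of the two scales. Through the common element all values on
  \<open>s \<union> t\<close> lie within n^2 \<delta> of \<open>x i\<close>, so the join has gap sum
  at most 2 n^4 \<delta>. If neither pipe contains the other, the join is larger than both and needs
  at least \<open>M\<close> times \<delta>.\<close>

lemma active_nested:
  assumes x: "feasible M x" and M: "M > 2 * real n ^ 4 + 1"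
    and s: "s \<in> active M x" "i \<in> s" and t: "t \<in> active M x" "i \<in> t"
  shows "s \<subseteq> t \<or> t \<subseteq> s"
proof (rule ccontr)
  assume neg: "\<not> ?thesis"
  have M1: "M > 1" using M by (smt (verit) zero_le_power of_nat_0_le_iff)
  have pp: "proper_pipe n le s" "proper_pipe n le t" using s t by (auto simp: active_def)
  define m where "m = max (card s) (card t)"
  define \<delta> where "\<delta> = M ^ m"
  have \<delta>0: "\<delta> > 0" using M1 by (simp add: \<delta>_def)
  have dist: "\<bar>x a - x i\<bar> \<le> real n ^ 2 * \<delta>" if a: "a \<in> u" and u: "u = s \<or> u = t" for a u
  proof (rule connected_diam[of u])
    have "u \<in> active M x" using s t u by auto
    moreover have "M ^ card u \<le> \<delta>" unfolding \<delta>_def m_def using u M1 by (intro power_increasing) auto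
    ultimately show "\<bar>x b - x c\<bar> \<le> \<delta>" if "b \<in> u" "c \<in> u" "lt b c" for b c
      using active_step[OF x, of u b c] that M1 by linarith
  qed (use a u s t pp \<delta>0 in auto)
  have D: "x b - x a \<le> 2 * real n ^ 2 * \<delta>" if "a \<in> s \<union> t" "b \<in> s \<union> t" for a b
  proof -
    have "\<bar>x a - x i\<bar> \<le> real n ^ 2 * \<delta>" "\<bar>x b - x i\<bar> \<le> real n ^ 2 * \<delta>"
      using dist[of a s] dist[of a t] dist[of b s] dist[of b t] that by auto
    then show ?thesis by linarith
  qed
  have "m \<le> n" using proper_pipe_card_le pp by (simp add: m_def)
  have "real n ^ 2 \<le> real n ^ 4" using n_pos by (intro power_increasing) auto
  then have "2 * real n ^ 2 * \<delta> < M * \<delta>" using M \<delta>0 by (intro mult_strict_right_mono) auto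
  also have "M * \<delta> \<le> M ^ Suc n" using \<open>m \<le> n\<close> M1 by (simp add: \<delta>_def power_increasing)
  also have "\<dots> \<le> real n * M ^ Suc n" using n_pos M1 by simp
  finally have L: "2 * real n ^ 2 * \<delta> < real n * M ^ Suc n" .
  obtain r where r: "proper_pipe n le r" "s \<union> t \<subseteq> r" "gap_sum r x \<le> real n ^ 2 * (2 * real n ^ 2 * \<delta>)"
    using pipe_join[OF pp(1) s(2) pp(2) t(2) le_refl feasible_quasi[OF x] _ L D]
      feasible_mono[OF x] M1 by auto
  have fin: "finite r" using r proper_pipe_finite by blast
  have "s \<subset> r" "t \<subset> r" using neg r by auto
  then have "card s < card r" "card t < card r" using fin by (auto intro: psubset_card_mono)
  then have "Suc m \<le> card r" by (simp add: m_def)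
  then have "M * \<delta> \<le> M ^ card r"
    using M1 power_increasing[of "Suc m" "card r" M] by (simp add: \<delta>_def)
  also have "\<dots> \<le> gap_sum r x" using x r by (simp add: feasible_def)
  also have "\<dots> \<le> (2 * real n ^ 4) * \<delta>" using r(3) by (simp add: power2_eq_square power4_eq_xxxx ac_simps)
  also have "\<dots> < M * \<delta>" using M \<delta>0 by (intro mult_strict_right_mono) auto
  finally show False by simp
qed

lemma active_acyclic:
  assumes x: "feasible M x" and M: "M > 2 * real n ^ 4 + 1"
  shows "acyclic (piping_digraph le (active M x))"
proof (rule acyclicI, rule allI, rule notI)
  fix s
  let ?T = "active M x"
  define G where "G = piping_digraph le ?T"
  assume "(s, s) \<in> (piping_digraph le ?T)\<^sup>+"
  then have ss: "(s, s) \<in> G\<^sup>+" by (simp add: G_def)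
  have M1: "M > 1" using M by (smt (verit) zero_le_power of_nat_0_le_iff)
  \<comment> \<open>The strongly connected component of \<open>s\<close>. A tube \<open>t0\<close>
    of largest cardinality in it has a scale \<delta> that bounds the steps inside every tube of the
    component, and joining it to a disjoint successor \<open>t1\<close> gives a pipe strictly larger
    than \<open>t0\<close>.\<close>
  define C where "C = {t. (s, t) \<in> G\<^sup>* \<and> (t, s) \<in> G\<^sup>*}"
  have GT: "t \<in> ?T \<and> u \<in> ?T" if "(t, u) \<in> G" for t u
    using that by (auto simp: G_def piping_digraph_def)
  have "s \<in> ?T" using ss GT by (meson tranclD)
  then have CT: "t \<in> ?T" if "t \<in> C" for t
    using that GT unfolding C_def by (metis (mono_tags, lifting) mem_Collect_eq rtranclE)
  then have CP: "proper_pipe n le t" if "t \<in> C" for t using that by (auto simp: active_def)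
  have "s \<in> C" by (simp add: C_def)
  then have "\<exists>t0. t0 \<in> C \<and> (\<forall>t. t \<in> C \<longrightarrow> card t \<le> card t0)"
    using proper_pipe_card_le[OF CP]
    by (intro ex_has_greatest_nat[of _ s _ "Suc n"]) (auto simp: less_Suc_eq_le)
  then obtain t0 where t0: "t0 \<in> C" "\<And>t. t \<in> C \<Longrightarrow> card t \<le> card t0" by blast
  then have "(s, t0) \<in> G\<^sup>*" "(t0, s) \<in> G\<^sup>*" by (simp_all add: C_def)
  then have "(t0, t0) \<in> G\<^sup>+"
    using rtrancl_trancl_trancl[OF _ trancl_rtrancl_trancl[OF ss]] by blast
  then obtain t1 where t1: "(t0, t1) \<in> G" "(t1, t0) \<in> G\<^sup>*" by (meson tranclD)
  then have "t1 \<in> C" using t0(1) unfolding C_def by (auto intro: rtrancl_trans rtrancl_into_rtrancl)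
  obtain i j where ij: "i \<in> t0" "j \<in> t1" "lt i j" and disj: "t0 \<inter> t1 = {}"
    using t1(1) by (auto simp: G_def piping_digraph_def)
  define \<delta> where "\<delta> = M ^ card t0"
  have \<delta>0: "\<delta> > 0" using M1 by (simp add: \<delta>_def)
  have step: "\<bar>x a - x b\<bar> \<le> \<delta>" if "t \<in> C" "a \<in> t" "b \<in> t" "lt a b \<or> lt b a" for t a b
  proof -
    have "M ^ card t \<le> \<delta>" unfolding \<delta>_def using t0 that M1 by (intro power_increasing) auto
    then show ?thesis
      using active_step[OF x _ CT[OF that(1)], of a b] active_step[OF x _ CT[OF that(1)], of b a] that M1
      by linarith
  qed
  have "real n * \<delta> < real n * M ^ Suc n"
    using M1 n_pos proper_pipe_card_le[OF CP[OF t0(1)]] unfolding \<delta>_def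
    by (intro mult_strict_left_mono power_strict_increasing) auto
  note L = this
  \<comment> \<open>A larger spread leaves room for an empty window of length \<delta>. No tube of
    \<open>C\<close> straddles it, since its steps are at most \<delta>, and edges of the digraph
    lead only upwards; so no path returns from the tube above the window to the one below.\<close>
  have D: "x b - x a \<le> real n * \<delta>" if ab: "a \<in> t0 \<union> t1" "b \<in> t0 \<union> t1" for a b
  proof (rule ccontr)
    assume far: "\<not> ?thesis"
    obtain u w where uw: "u \<in> C" "a \<in> u" "w \<in> C" "b \<in> w" using ab t0 \<open>t1 \<in> C\<close> by blast
    obtain c where c: "x a \<le> c" "c + \<delta> \<le> x a + real n * \<delta>" "\<And>i. x i \<le> c \<or> c + \<delta> < x i"
      using empty_window[OF feasible_quasi[OF x] \<delta>0 L] by blast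
    have above: "\<forall>q\<in>t. c + \<delta> < x q" if t: "t \<in> C" "p \<in> t" "c + \<delta> < x p" for t p
    proof (rule ccontr)
      assume "\<not> ?thesis"
      then obtain q where q: "q \<in> t" "x q \<le> c" using c(3) by blast
      have "\<not> t \<subseteq> {i. x i \<le> c}" using t \<delta>0 by force
      then obtain y z where "y \<in> t" "z \<in> t" "x y \<le> c" "\<not> x z \<le> c" "lt y z \<or> lt z y"
        using connected_exit[OF proper_pipe_connected[OF CP[OF t(1)]] q(1), of "{i. x i \<le> c}"] q(2)
        by auto
      then show False using step[OF t(1), of y z] c(3)[of z] by linarith
    qed
    have "(w, u) \<in> G\<^sup>*" using uw unfolding C_def by (auto intro: rtrancl_trans)
    have "\<forall>q\<in>t. c + \<delta> < x q" if "(w, t) \<in> G\<^sup>*" "(t, u) \<in> G\<^sup>*" for t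
      using that
    proof (induction rule: rtrancl_induct)
      case base
      show ?case using above[OF uw(3,4)] far c(2) by linarith
    next
      case (step t t')
      have "(t, u) \<in> G\<^sup>*" using step by (meson converse_rtrancl_into_rtrancl)
      then have t: "\<forall>q\<in>t. c + \<delta> < x q" using step.IH by blast
      have "t' \<in> C" using step uw unfolding C_def by (auto intro: rtrancl_trans rtrancl_into_rtrancl)
      obtain p q where pq: "p \<in> t" "q \<in> t'" "lt p q"
        using step.hyps(2) by (auto simp: G_def piping_digraph_def)
      then have "x p \<le> x q" using feasible_mono[OF x] M1 by (simp add: strict_def)
      then show ?case using above[OF \<open>t' \<in> C\<close> pq(2)] t pq by force
    qed
    then show False using \<open>(w, u) \<in> G\<^sup>*\<close> uw c \<delta>0 by force
  qed
  obtain r where r: "proper_pipe n le r" "t0 \<union> t1 \<subseteq> r" "gap_sum r x \<le> real n ^ 2 * (real n * \<delta>)"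
    using pipe_join[OF CP[OF t0(1)] ij(1) CP[OF \<open>t1 \<in> C\<close>] ij(2) lt_imp_le[OF ij(3)] feasible_quasi[OF x] _ L D]
      feasible_mono[OF x] M1 by auto
  have "t0 \<subset> r" using r ij disj by blast
  then have "card t0 < card r" using r proper_pipe_finite psubset_card_mono by blast
  then have "M * \<delta> \<le> M ^ card r"
    using M1 power_increasing[of "Suc (card t0)" "card r" M] by (simp add: \<delta>_def)
  also have "\<dots> \<le> gap_sum r x" using x r by (simp add: feasible_def)
  also have "\<dots> \<le> real n ^ 3 * \<delta>" using r(3) by (simp add: power2_eq_square power3_eq_cube ac_simps)
  also have "\<dots> < M * \<delta>"
  proof (rule mult_strict_right_mono)
    have "real n ^ 3 \<le> real n ^ 4" using n_pos by (intro power_increasing) auto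
    then show "real n ^ 3 < M" using M zero_le_power[of "real n" 4] by linarith
  qed (rule \<delta>0)
  finally show False by simp
qed

lemma active_piping:
  assumes x: "feasible M x" and M: "M > 2 * real n ^ 4 + 1"
  shows "proper_piping n le (active M x)"
proof (rule proper_pipingI)
  show "shift d t \<in> active M x" if "t \<in> active M x" for t d
  proof -
    have "card (shift d t) = card t" by (simp add: card_image inj_on_def)
    then show ?thesis
      using that proper_pipe_shift gap_sum_shift_quasi[OF feasible_quasi[OF x]] by (simp add: active_def)
  qed
  show "s \<subseteq> t \<or> t \<subseteq> s \<or> s \<inter> t = {}" if "s \<in> active M x" "t \<in> active M x" for s t
    using active_nested[OF x M that(1) _ that(2)] by blast
qed (use active_acyclic[OF x M] in \<open>auto simp: active_def\<close>)

section \<open>Realizing a piping\<close>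

text \<open>If \<open>i\<close> precedes \<open>j\<close> in a pipe, then \<open>j\<close> is not
  far below \<open>i\<close>, by antisymmetry, nor far above, as convexity would then put
  \<open>i + n\<close> into the pipe. Connectedness extends this to all pairs.\<close>

lemma pipe_diam:
  obtains K where "\<And>t i j. proper_pipe n le t \<Longrightarrow> i \<in> t \<Longrightarrow> j \<in> t \<Longrightarrow> \<bar>i - j\<bar> \<le> K"
proof -
  obtain c where c: "c \<ge> 0" "\<And>i j. i + c \<le> j \<Longrightarrow> le i j"
    using far_le by blast
  have step: "\<bar>i - j\<bar> \<le> int n + c" if t: "proper_pipe n le t" "i \<in> t" "j \<in> t" "lt i j" for t i j
  proof -
    have "j + c > i" using c(2)[of j i] t(4) le_antisym by (force simp: strict_def)
    moreover have "i + int n + c > j"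
    proof (rule ccontr)
      assume "\<not> ?thesis"
      then have "le (i + 1 * int n) j" using c(2) by simp
      then have "i + 1 * int n \<in> t"
        using le_add_mult[of 1 i] poset_convexD[OF proper_pipe_convex[OF t(1)] t(2,3)] by simp
      then show False using proper_pipe_shift_mem[OF t(1,2)] by fastforce
    qed
    ultimately show ?thesis by linarith
  qed
  have "\<bar>i - j\<bar> \<le> int n ^ 2 * (int n + c)" if t: "proper_pipe n le t" "i \<in> t" "j \<in> t" for t i j
  proof -
    have "\<bar>real_of_int a - real_of_int b\<bar> \<le> of_int (int n + c)" if "a \<in> t" "b \<in> t" "lt a b" for a b
      using step[OF t(1) that] by linarith
    then have "\<bar>real_of_int i - real_of_int j\<bar> \<le> real n ^ 2 * of_int (int n + c)"
      using c(1) by (intro connected_diam[OF t]) auto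
    then have "real_of_int \<bar>i - j\<bar> \<le> of_int (int n ^ 2 * (int n + c))" by simp
    then show ?thesis by (simp only: of_int_le_iff)
  qed
  then show thesis using that by blast
qed

lemma pipe_class_shift: "pipe_class n (shift d t) = pipe_class n t"
proof
  show "pipe_class n (shift d t) \<subseteq> pipe_class n t"
    unfolding pipe_class_def using shift_shift by blast
  have "shift e t = shift (e - d) (shift d t)" for e by (simp add: shift_shift)
  then show "pipe_class n t \<subseteq> pipe_class n (shift d t)"
    unfolding pipe_class_def by blast
qed

text \<open>Each class has a member meeting the residues from 0 to n - 1, and diameters are
  bounded.\<close>

lemma finite_pipe_classes: "finite (pipe_class n ` {t. proper_pipe n le t})"
proof -
  obtain K where K: "\<And>t i j. proper_pipe n le t \<Longrightarrow> i \<in> t \<Longrightarrow> j \<in> t \<Longrightarrow> \<bar>i - j\<bar> \<le> K"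
    using pipe_diam by blast
  have "pipe_class n ` {t. proper_pipe n le t} \<subseteq> pipe_class n ` Pow {- K..int n + K}"
  proof clarify
    fix t assume t: "proper_pipe n le t"
    then obtain i where i: "i \<in> t" using proper_pipe_nonempty by blast
    let ?t = "shift (- (i div int n)) t"
    have "i + - (i div int n) * int n = i mod int n"
      by (simp add: minus_div_mult_eq_mod)
    then have "i mod int n \<in> ?t" using i by (metis imageI)
    moreover have "proper_pipe n le ?t" using t by (rule proper_pipe_shift)
    ultimately have "\<bar>j - i mod int n\<bar> \<le> K" if "j \<in> ?t" for j using K that by blast
    moreover have "0 \<le> i mod int n" "i mod int n < int n" using n_pos by auto
    ultimately have "j \<in> {- K..int n + K}" if "j \<in> ?t" for j
      using that by (simp only: abs_le_iff atLeastAtMost_iff) (smt (verit))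
    then have "?t \<subseteq> {- K..int n + K}" by blast
    then show "pipe_class n t \<in> pipe_class n ` Pow {- K..int n + K}"
      using pipe_class_shift by (metis PowI imageI)
  qed
  then show ?thesis using finite_subset by blast
qed

lemma is_height_add: "is_height T h \<Longrightarrow> h (i + d * int n) = h i + d * int n"
  unfolding is_height_def by (drule conjunct1) simp

lemma is_height_mono: "is_height T h \<Longrightarrow> le i j \<Longrightarrow> h i \<le> h j"
  unfolding is_height_def by (drule conjunct2, drule conjunct1) simp

lemma is_height_less:
  "is_height T h \<Longrightarrow> lt i j \<Longrightarrow> (\<And>s. s \<in> T \<Longrightarrow> i \<in> s \<Longrightarrow> j \<notin> s) \<Longrightarrow> h i < h j"
  unfolding is_height_def by (drule conjunct2, drule conjunct2, drule conjunct2) simp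

text \<open>\<open>B\<close> is independent of \<open>T\<close> and \<open>h\<close>, since
  \<open>M\<close> is computed from it before any piping is chosen. Any two elements of a pipe lie
  below bounded translates of each other, and heights translate rigidly.\<close>

lemma height_bound:
  obtains B :: real where "B \<ge> 1"
    "\<And>T h t i j. is_height T h \<Longrightarrow> proper_pipe n le t \<Longrightarrow> i \<in> t \<Longrightarrow> j \<in> t \<Longrightarrow> \<bar>of_int (h i) - of_int (h j)\<bar> \<le> B"
proof -
  obtain c where c: "c \<ge> 0" "\<And>i j. i + c \<le> j \<Longrightarrow> le i j"
    using far_le by blast
  obtain K where K: "\<And>t i j. proper_pipe n le t \<Longrightarrow> i \<in> t \<Longrightarrow> j \<in> t \<Longrightarrow> \<bar>i - j\<bar> \<le> K"
    using pipe_diam by blast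
  define q where "q = \<bar>K\<bar> + c + 1"
  have "q * 1 \<le> q * int n" using n_pos c by (intro mult_left_mono) (auto simp: q_def)
  then have qn: "q \<le> q * int n" by simp
  have le: "h j \<le> h i + q * int n" if h: "is_height T h" and t: "proper_pipe n le t" "i \<in> t" "j \<in> t" for T h t i j
  proof -
    have "le j (i + q * int n)" using K[OF t] qn by (intro c(2)) (auto simp: q_def)
    then have "h j \<le> h (i + q * int n)" by (rule is_height_mono[OF h])
    then show ?thesis by (simp only: is_height_add[OF h])
  qed
  have "\<bar>real_of_int (h i) - of_int (h j)\<bar> \<le> of_int (q * int n)"
    if "is_height T h" "proper_pipe n le t" "i \<in> t" "j \<in> t" for T h t i j
    using le[OF that] le[OF that(1,2,4,3)] by linarith
  moreover have "q \<ge> 1" using c(1) by (simp add: q_def)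
  then have "q * int n \<ge> 1" using qn by linarith
  then have "real_of_int (q * int n) \<ge> 1" by linarith
  ultimately show thesis using that by blast
qed

text \<open>Supplies a pair in \<open>r\<close> on which every height of \<open>S\<close> jumps by
  at least 1. Start anywhere in \<open>r\<close> and leave the maximal tube around the starting
  point, or the point itself if no tube contains it.\<close>

lemma piping_exit:
  assumes S: "proper_piping n le S" and r: "proper_pipe n le r" and out: "\<And>s. s \<in> S \<Longrightarrow> \<not> r \<subseteq> s"
  obtains i j where "i \<in> r" "j \<in> r" "lt i j" "\<And>s. s \<in> S \<Longrightarrow> i \<in> s \<Longrightarrow> j \<notin> s"
proof -
  obtain i0 where i0: "i0 \<in> r" using r proper_pipe_nonempty by blast
  have "\<exists>a b. a \<in> r \<and> b \<in> r \<and> (lt a b \<or> lt b a) \<and> (\<forall>s\<in>S. a \<in> s \<longrightarrow> b \<notin> s)"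
  proof (cases "\<exists>s\<in>S. i0 \<in> s")
    case False
    have "\<not> r \<subseteq> {i0}"
      using proper_pipe_card[OF r] card_mono[of "{i0}" r] by auto
    then obtain a b where "a \<in> r" "b \<in> r" "a \<in> {i0}" "b \<notin> {i0}" "lt a b \<or> lt b a"
      using connected_exit[OF proper_pipe_connected[OF r] i0 singletonI] by metis
    then show ?thesis using False by blast
  next
    case True
    then obtain s0 where s0: "s0 \<in> S" "i0 \<in> s0" by blast
    then obtain m where m: "m \<in> S" "s0 \<subseteq> m" "\<And>t. t \<in> S \<Longrightarrow> m \<subseteq> t \<Longrightarrow> m = t"
      using piping_maximal[OF S s0(1)] by blast
    then obtain a b where ab: "a \<in> r" "b \<in> r" "a \<in> m" "b \<notin> m" "lt a b \<or> lt b a"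
      using connected_exit[OF proper_pipe_connected[OF r] i0, of m] out[OF m(1)] s0 by blast
    have "b \<notin> s" if "s \<in> S" "a \<in> s" for s
      using piping_nested[OF S that(1) m(1) that(2) ab(3)] m(3)[OF that(1)] ab(4) by blast
    then show ?thesis using ab by blast
  qed
  then show thesis using that by blast
qed

text \<open>All translates of \<open>t\<close> are allowed so that the family is periodic, hence
  again a piping, and is the same for every translate of \<open>t\<close>.\<close>

definition inner_tubes :: "int set set \<Rightarrow> int set \<Rightarrow> int set set" where
  "inner_tubes T t = {s \<in> T. \<exists>d. s \<subset> shift d t}"

lemma inner_tubes_UNIV:
  assumes "proper_piping n le T"
  shows "inner_tubes T UNIV = T"
proof -
  have "shift d UNIV = UNIV" for d
    by (rule surjI[of _ "\<lambda>i. i - d * int n"]) simp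
  moreover have "s \<noteq> UNIV" if "s \<in> T" for s
    using piping_pipe[OF assms that] by (simp add: proper_pipe_def)
  ultimately show ?thesis by (auto simp: inner_tubes_def)
qed

lemma inner_tubes_shift: "inner_tubes T (shift d t) = inner_tubes T t"
proof -
  have "(\<exists>e. s \<subset> shift (e + d) t) \<longleftrightarrow> (\<exists>e. s \<subset> shift e t)" for s
    by (metis diff_add_cancel)
  then show ?thesis by (simp add: inner_tubes_def shift_shift)
qed

lemma inner_tubes_piping:
  assumes T: "proper_piping n le T"
  shows "proper_piping n le (inner_tubes T t)"
proof (rule proper_piping_subset[OF T])
  show "shift e s \<in> inner_tubes T t" if s': "s \<in> inner_tubes T t" for s e
  proof -
    obtain d where s: "s \<in> T" "s \<subset> shift d t" using s' unfolding inner_tubes_def by blast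
    have "inj_on (\<lambda>i. i + e * int n) (shift d t)" by (simp add: inj_on_def)
    then have "shift e s \<subset> shift e (shift d t)" using s(2) by (rule image_strict_mono)
    then show ?thesis using piping_shift[OF T s(1)] unfolding shift_shift inner_tubes_def by blast
  qed
qed (auto simp: inner_tubes_def)

text \<open>Take the smallest tube around \<open>A\<close>, with \<open>UNIV\<close> as the default;
  its scale governs the differences inside \<open>A\<close>.\<close>

lemma inner_tubes_minimal:
  assumes T: "proper_piping n le T" and "A \<noteq> {}"
  obtains t where "t \<in> insert UNIV T" "A \<subseteq> t" "\<And>s. s \<in> inner_tubes T t \<Longrightarrow> \<not> A \<subseteq> s"
proof (cases "\<exists>t\<in>T. A \<subseteq> t")
  case False
  then show thesis using that[of UNIV] by (auto simp: inner_tubes_def)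
next
  case True
  then have "\<exists>t. (t \<in> T \<and> A \<subseteq> t) \<and> (\<forall>s. s \<in> T \<and> A \<subseteq> s \<longrightarrow> card t \<le> card s)"
    using ex_has_least_nat[of "\<lambda>t. t \<in> T \<and> A \<subseteq> t" _ card] by blast
  then obtain t where t: "t \<in> T" "A \<subseteq> t" "\<And>s. s \<in> T \<Longrightarrow> A \<subseteq> s \<Longrightarrow> card t \<le> card s"
    by blast
  have pt: "proper_pipe n le t" using piping_pipe[OF T t(1)] .
  have "\<not> A \<subseteq> s" if s: "s \<in> inner_tubes T t" for s
  proof
    assume "A \<subseteq> s"
    obtain d where d: "s \<in> T" "s \<subset> shift d t" using s unfolding inner_tubes_def by blast
    then have "card s < card (shift d t)"
      using proper_pipe_finite[OF pt] by (intro psubset_card_mono) auto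
    also have "\<dots> = card t" by (simp add: card_image inj_on_def)
    finally show False using t(3)[OF d(1) \<open>A \<subseteq> s\<close>] by simp
  qed
  then show thesis using that t by blast
qed

lemma inner_tubes_self:
  assumes T: "proper_piping n le T" and t: "t \<in> T" and "s \<in> inner_tubes T t"
  shows "\<not> t \<subseteq> s"
proof
  assume "t \<subseteq> s"
  obtain d where d: "s \<in> T" "s \<subset> shift d t" using assms unfolding inner_tubes_def by blast
  have "finite t" using T t piping_pipe proper_pipe_finite by blast
  then have "card s < card (shift d t)" using d by (intro psubset_card_mono) auto
  also have "\<dots> = card t" by (simp add: card_image inj_on_def)
  also have "\<dots> \<le> card s"
    using \<open>t \<subseteq> s\<close> d T piping_pipe proper_pipe_finite by (intro card_mono) blast+
  finally show False by simp
qed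

text \<open>The choice depends on \<open>t\<close> only through \<open>inner_tubes T t\<close>, so
  translates of \<open>t\<close> receive literally the same function.\<close>

definition height :: "int set set \<Rightarrow> int set \<Rightarrow> int \<Rightarrow> real" where
  "height T t i = of_int ((SOME h. is_height (inner_tubes T t) h) i)"

text \<open>For \<open>t = UNIV\<close> the minimum is junk, but this case is never used.\<close>

definition rel_height :: "int set set \<Rightarrow> int set \<Rightarrow> int \<Rightarrow> real" where
  "rel_height T t i = height T t i - height T t (Min t)"

section \<open>Weights and the multi-scale function realizing a fixed piping\<close>

context
  fixes T and M :: real
  assumes T: "proper_piping n le T"
begin

lemma
  shows height_add: "height T t (i + d * int n) = height T t i + of_int d * real n"
    and height_mono: "le i j \<Longrightarrow> height T t i \<le> height T t j"
    and height_eq: "s \<in> inner_tubes T t \<Longrightarrow> i \<in> s \<Longrightarrow> j \<in> s \<Longrightarrow> height T t i = height T t j"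
    and height_less: "lt i j \<Longrightarrow> (\<And>s. s \<in> inner_tubes T t \<Longrightarrow> i \<in> s \<Longrightarrow> j \<notin> s) \<Longrightarrow> height T t i + 1 \<le> height T t j"
    and is_height_height: "\<exists>h. is_height (inner_tubes T t) h \<and> height T t = (\<lambda>i. of_int (h i))"
proof -
  define h where "h = (SOME h. is_height (inner_tubes T t) h)"
  have h: "is_height (inner_tubes T t) h"
    unfolding h_def using piping_height_exists[OF inner_tubes_piping[OF T]] by (rule someI_ex)
  have eq: "height T t i = of_int (h i)" for i by (simp add: height_def h_def)
  show "height T t (i + d * int n) = height T t i + of_int d * real n"
    by (simp add: eq is_height_add[OF h])
  show "height T t i \<le> height T t j" if "le i j" using is_height_mono[OF h that] by (simp add: eq)
  show "height T t i = height T t j" if "s \<in> inner_tubes T t" "i \<in> s" "j \<in> s"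
  proof -
    have "h i = h j" using h that unfolding is_height_def by blast
    then show ?thesis by (simp add: eq)
  qed
  show "height T t i + 1 \<le> height T t j" if "lt i j" "\<And>s. s \<in> inner_tubes T t \<Longrightarrow> i \<in> s \<Longrightarrow> j \<notin> s"
  proof -
    have "h i < h j" using is_height_less[OF h that] .
    then show ?thesis unfolding eq by linarith
  qed
  show "\<exists>h. is_height (inner_tubes T t) h \<and> height T t = (\<lambda>i. of_int (h i))"
    by (intro exI[of _ h] conjI ext h eq)
qed

lemma height_shift: "height T (shift d t) = height T t"
  by (simp add: height_def inner_tubes_shift fun_eq_iff)

lemma rel_height_shift:
  assumes "finite t" "t \<noteq> {}"
  shows "rel_height T (shift d t) (i + d * int n) = rel_height T t i"
proof -
  have "Min (shift d t) = Min t + d * int n"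
    using mono_Min_commute[of "\<lambda>i. i + d * int n" t] assms by (simp add: mono_def)
  then show ?thesis by (simp add: rel_height_def height_shift height_add)
qed

text \<open>For a tube \<open>t\<close> this solves \<open>gap_sum t (\<lambda>i. weight t * height
  T t i + tail t i) = M ^ card t\<close> for the weight. The tail is written out because it is
  itself built from the weights of smaller tubes.\<close>

function weight :: "int set \<Rightarrow> real" where
  "weight t = (if finite t then
     (M ^ card t - gap_sum t (\<lambda>i. \<Sum>s\<in>{s \<in> T. i \<in> s \<and> s \<subset> t}. weight s * rel_height T s i))
       / gap_sum t (height T t) else 0)"
  by pat_completeness auto
termination
  by (relation "Wellfounded.measure card") (auto intro: psubset_card_mono)

declare weight.simps [simp del]

definition tail :: "int set \<Rightarrow> int \<Rightarrow> real" where
  "tail t i = (\<Sum>s\<in>{s \<in> T. i \<in> s \<and> s \<subset> t}. weight s * rel_height T s i)"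

text \<open>\<open>UNIV\<close> serves as the outermost tube; its weight is prescribed instead of
  being solved for.\<close>

definition realization :: "int \<Rightarrow> real" where
  "realization i = M ^ Suc n * height T UNIV i + tail UNIV i"

lemma weight_eq:
  "t \<in> T \<Longrightarrow> weight t = (M ^ card t - gap_sum t (tail t)) / gap_sum t (height T t)"
  using proper_pipe_finite[OF piping_pipe[OF T]] by (simp add: weight.simps[of t] tail_def[abs_def])

text \<open>Invariance of the smaller weights is a hypothesis here so that the induction for
  \<open>weight_shift\<close> can discharge it.\<close>

lemma tail_shift_aux:
  assumes "\<And>s. s \<in> T \<Longrightarrow> s \<subset> t \<Longrightarrow> weight (shift d s) = weight s"
  shows "tail (shift d t) (i + d * int n) = tail t i"
proof -
  have inj: "inj (\<lambda>i. i + d * int n)" by (simp add: inj_on_def)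
  have mem: "i + d * int n \<in> shift d s \<longleftrightarrow> i \<in> s" for i s by auto
  have sub: "shift d s \<subset> shift d t \<longleftrightarrow> s \<subset> t" for s
    using inj by (simp add: inj_image_subset_iff psubset_eq inj_image_eq_iff)
  have "{s \<in> T. i + d * int n \<in> s \<and> s \<subset> shift d t} = shift d ` {s \<in> T. i \<in> s \<and> s \<subset> t}"
  proof
    show "shift d ` {s \<in> T. i \<in> s \<and> s \<subset> t} \<subseteq> {s \<in> T. i + d * int n \<in> s \<and> s \<subset> shift d t}"
    proof (rule image_subsetI)
      fix s assume "s \<in> {s \<in> T. i \<in> s \<and> s \<subset> t}"
      then show "shift d s \<in> {s \<in> T. i + d * int n \<in> s \<and> s \<subset> shift d t}"
        by (simp only: mem_Collect_eq mem sub piping_shift[OF T])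
    qed
    show "{s \<in> T. i + d * int n \<in> s \<and> s \<subset> shift d t} \<subseteq> shift d ` {s \<in> T. i \<in> s \<and> s \<subset> t}"
    proof
      fix s assume s: "s \<in> {s \<in> T. i + d * int n \<in> s \<and> s \<subset> shift d t}"
      have eq: "s = shift d (shift (- d) s)" by (simp only: shift_shift) simp
      then have "shift (- d) s \<in> {s \<in> T. i \<in> s \<and> s \<subset> t}"
        using s piping_shift[OF T, of s "- d"] mem[of i "shift (- d) s"] sub[of "shift (- d) s"]
        unfolding eq[symmetric] by blast
      then show "s \<in> shift d ` {s \<in> T. i \<in> s \<and> s \<subset> t}" using eq by blast
    qed
  qed
  moreover have "inj_on (shift d) X" for X
    unfolding inj_on_def inj_image_eq_iff[OF inj] by simp
  ultimately have "tail (shift d t) (i + d * int n) =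
      (\<Sum>s\<in>{s \<in> T. i \<in> s \<and> s \<subset> t}. weight (shift d s) * rel_height T (shift d s) (i + d * int n))"
    unfolding tail_def by (simp only: sum.reindex comp_def)
  also have "\<dots> = tail t i"
    unfolding tail_def
  proof (rule sum.cong)
    fix s assume s: "s \<in> {s \<in> T. i \<in> s \<and> s \<subset> t}"
    then have "finite s" using proper_pipe_finite[OF piping_pipe[OF T]] by blast
    then show "weight (shift d s) * rel_height T (shift d s) (i + d * int n) = weight s * rel_height T s i"
      using s rel_height_shift[of s d i] assms[of s] by force
  qed simp
  finally show ?thesis .
qed

lemma weight_shift: "t \<in> T \<Longrightarrow> weight (shift d t) = weight t"
proof (induction "card t" arbitrary: t rule: less_induct)
  case less
  have "finite t" using less.prems proper_pipe_finite piping_pipe[OF T] by blast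
  then have "weight (shift d s) = weight s" if "s \<in> T" "s \<subset> t" for s
    using less.hyps that psubset_card_mono by blast
  then have "gap_sum (shift d t) (tail (shift d t)) = gap_sum t (tail t)"
    by (simp add: gap_sum_shift tail_shift_aux)
  moreover have "gap_sum (shift d t) (height T (shift d t)) = gap_sum t (height T t)"
    unfolding gap_sum_shift height_shift height_add by (rule gap_sum_cong) simp
  moreover have "card (shift d t) = card t" by (simp add: card_image inj_on_def)
  ultimately show ?case
    using weight_eq[OF less.prems] weight_eq[OF piping_shift[OF T less.prems]] by simp
qed

lemma tail_shift: "tail (shift d t) (i + d * int n) = tail t i"
  by (simp add: tail_shift_aux weight_shift)

lemma realization_quasi: "quasi_periodic (real n * M ^ Suc n) realization"
proof -
  have "shift d UNIV = UNIV" for d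
    by (rule surjI[of _ "\<lambda>i. i - d * int n"]) simp
  then have "tail UNIV (i + d * int n) = tail UNIV i" for i d
    using tail_shift[of d UNIV i] by simp
  then show ?thesis
    by (simp add: quasi_periodic_def realization_def height_add algebra_simps)
qed

lemma finite_tubes_at: "finite {s \<in> T. i \<in> s}"
proof -
  obtain K where K: "\<And>t i j. proper_pipe n le t \<Longrightarrow> i \<in> t \<Longrightarrow> j \<in> t \<Longrightarrow> \<bar>i - j\<bar> \<le> K"
    using pipe_diam by blast
  have "{s \<in> T. i \<in> s} \<subseteq> Pow {i - K..i + K}"
  proof clarify
    fix s j assume "s \<in> T" "i \<in> s" "j \<in> s"
    then have "\<bar>i - j\<bar> \<le> K" using K piping_pipe[OF T] by blast
    then show "j \<in> {i - K..i + K}" by auto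
  qed
  then show ?thesis by (rule finite_subset) simp
qed

text \<open>The tubes through \<open>i\<close> form a chain, so their cardinalities are
  distinct.\<close>

lemma card_tubes_at: "card {s \<in> T. i \<in> s} \<le> n"
proof -
  have "inj_on card {s \<in> T. i \<in> s}"
  proof (rule inj_onI)
    fix s t assume st: "s \<in> {s \<in> T. i \<in> s}" "t \<in> {s \<in> T. i \<in> s}" "card s = card t"
    then have "finite s" "finite t" "s \<subseteq> t \<or> t \<subseteq> s"
      using proper_pipe_finite piping_pipe[OF T] piping_nested[OF T] by blast+
    then show "s = t" using st(3) card_subset_eq by metis
  qed
  moreover have "card ` {s \<in> T. i \<in> s} \<subseteq> {1..n}"
    using proper_pipe_card_le[OF piping_pipe[OF T]] proper_pipe_card[OF piping_pipe[OF T]]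
    by (force simp: Suc_le_eq)
  ultimately have "card {s \<in> T. i \<in> s} \<le> card {1..n}" by (intro card_inj_on_le) auto
  then show ?thesis by simp
qed

text \<open>Inside a tube \<open>t\<close> the summands of the realization coming from larger tubes are constant.\<close>

lemma realization_diff:
  assumes t: "t \<in> T" and ij: "i \<in> t" "j \<in> t"
  shows "realization j - realization i = weight t * (height T t j - height T t i) + (tail t j - tail t i)"
proof -
  let ?f = "\<lambda>k s. weight s * rel_height T s k"
  have U: "s \<noteq> UNIV" if "s \<in> T" for s using piping_pipe[OF T that] by (simp add: proper_pipe_def)
  have split: "tail UNIV k = tail t k + ?f k t + (\<Sum>s\<in>{s \<in> T. t \<subset> s}. ?f k s)" if k: "k \<in> t" for k
  proof -
    let ?A = "{s \<in> T. k \<in> s \<and> s \<subset> t}" and ?B = "{s \<in> T. t \<subset> s}"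
    have "{s \<in> T. k \<in> s \<and> s \<subset> UNIV} = ?A \<union> insert t ?B"
      using piping_nested[OF T _ t _ k] k t U by blast
    moreover have "finite ?A" "finite ?B"
      using k by (auto intro: finite_subset[OF _ finite_tubes_at[of k]])
    moreover have "?A \<inter> insert t ?B = {}" "t \<notin> ?B" by blast+
    ultimately show ?thesis
      unfolding tail_def by (simp only: sum.union_disjoint sum.insert finite_insert) simp
  qed
  have "(\<Sum>s\<in>{s \<in> T. t \<subset> s}. ?f j s) = (\<Sum>s\<in>{s \<in> T. t \<subset> s}. ?f i s)"
  proof (rule sum.cong)
    fix s assume "s \<in> {s \<in> T. t \<subset> s}"
    then have "t \<in> inner_tubes T s" using t unfolding inner_tubes_def by (auto intro!: exI[of _ 0])
    then show "?f j s = ?f i s" using height_eq[OF _ ij] by (simp add: rel_height_def)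
  qed simp
  moreover have "height T UNIV i = height T UNIV j"
    using t ij inner_tubes_UNIV[OF T] by (intro height_eq[of t]) auto
  ultimately show ?thesis
    using split[OF ij(1)] split[OF ij(2)] by (simp add: realization_def rel_height_def algebra_simps)
qed

end

lemma realization_correct:
  assumes T: "proper_piping n le T" and B: "B \<ge> 1"
    and bound: "\<And>T h t i j. is_height T h \<Longrightarrow> proper_pipe n le t \<Longrightarrow> i \<in> t \<Longrightarrow> j \<in> t \<Longrightarrow>
      \<bar>of_int (h i) - of_int (h j)\<bar> \<le> B"
    and M: "M \<ge> 8 * real n ^ 3 * B" "M > 2 * real n ^ 2 * B * (4 * real n * B + 1)" "M > 1"
  shows "feasible M (realization T M)" and "active M (realization T M) = T"
proof -
  define W where "W = weight T M"
  define H where "H = height T"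
  define Y where "Y = tail T M"
  define X where "X = realization T M"
  \<comment> \<open>With n + 1 for \<open>UNIV\<close>, \<open>M ^ e t\<close> is the scale of every
    tube, the outermost included, and \<open>e t - 1\<close> bounds the cardinality of each proper
    pipe strictly inside \<open>t\<close>.\<close>
  define e where "e t = (if t = UNIV then Suc n else card t)" for t :: "int set"
  define V where "V t = (if t = UNIV then M ^ Suc n else W t)" for t
  define N where "N = real n ^ 2"
  have n1: "real n \<ge> 1" using n_pos by simp
  then have N1: "N \<ge> 1" by (simp add: N_def)
  have pp: "proper_pipe n le t" if "t \<in> T" for t using piping_pipe[OF T that] .
  have U: "t \<noteq> UNIV" if "t \<in> T" for t using pp[OF that] by (simp add: proper_pipe_def)
  have HB: "\<bar>H t i - H t j\<bar> \<le> B" if r: "proper_pipe n le r" "i \<in> r" "j \<in> r" for t r i j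
    using is_height_height[OF T, of t] bound[OF _ r] by (auto simp: H_def)
  have relB: "\<bar>rel_height T s i\<bar> \<le> B" if "s \<in> T" "i \<in> s" for s i
  proof -
    have "Min s \<in> s" using that proper_pipe_finite[OF pp[OF that(1)]] by (intro Min_in) auto
    then show ?thesis
      using HB[OF pp[OF that(1)] that(2), of "Min s" s] by (simp add: rel_height_def H_def)
  qed
  have tail_bound: "\<bar>Y t i\<bar> \<le> 2 * real n * B * E"
    if E: "E \<ge> 0" "\<And>s. s \<in> T \<Longrightarrow> s \<subset> t \<Longrightarrow> 0 \<le> W s \<and> W s \<le> 2 * E" for t i E
  proof -
    let ?S = "{s \<in> T. i \<in> s \<and> s \<subset> t}"
    have "?S \<subseteq> {s \<in> T. i \<in> s}" by blast
    then have "card ?S \<le> n"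
      by (rule order_trans[OF card_mono[OF finite_tubes_at[OF T]] card_tubes_at[OF T]])
    then have card: "real (card ?S) \<le> real n" by simp
    have "\<bar>Y t i\<bar> \<le> (\<Sum>s\<in>?S. \<bar>W s * rel_height T s i\<bar>)"
      unfolding Y_def tail_def[OF T] W_def by (rule sum_abs)
    also have "\<dots> \<le> real (card ?S) * (2 * E * B)"
    proof (rule sum_bounded_above)
      fix s assume s: "s \<in> ?S"
      then have "\<bar>W s\<bar> \<le> 2 * E" using E(2)[of s] by auto
      then show "\<bar>W s * rel_height T s i\<bar> \<le> 2 * E * B"
        unfolding abs_mult using relB[of s i] s E(1) by (intro mult_mono) auto
    qed
    also have "\<dots> \<le> real n * (2 * E * B)"
      using card E(1) B by (intro mult_right_mono) auto
    finally show ?thesis by (simp add: ac_simps)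
  qed
  have psub: "card s \<le> e t - 1" if "s \<in> T" "s \<subset> t" "t \<in> insert UNIV T" for s t
    using proper_pipe_card_le[OF pp[OF that(1)]] that psubset_card_mono[of t s] proper_pipe_finite[OF pp, of t]
    by (auto simp: e_def)
  have g: "1 \<le> gap_sum t (H t)" "gap_sum t (H t) \<le> N * B" if t: "t \<in> T" for t
  proof -
    show "gap_sum t (H t) \<le> N * B"
      unfolding N_def using HB[OF pp[OF t]] B by (intro gap_sum_le[OF pp[OF t]]) (auto simp: abs_le_iff)
    obtain i j where ij: "i \<in> t" "j \<in> t" "lt i j" "\<And>s. s \<in> inner_tubes T t \<Longrightarrow> i \<in> s \<Longrightarrow> j \<notin> s"
      using piping_exit[OF inner_tubes_piping[OF T] pp[OF t]] inner_tubes_self[OF T t] by blast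
    then have "1 \<le> H t j - H t i"
      unfolding H_def le_diff_eq by (subst add.commute) (rule height_less[OF T ij(3,4)])
    also have "\<dots> \<le> gap_sum t (H t)"
      using height_mono[OF T] ij proper_pipe_finite[OF pp[OF t]]
      by (intro gap_le_gap_sum) (auto simp: H_def)
    finally show "1 \<le> gap_sum t (H t)" .
  qed
  \<comment> \<open>With E = \<open>M ^ (card t - 1)\<close>, the tail is at most 2 n B E in
    absolute value, so its gap sum is at most 4 n^3 B E, which the first bound on \<open>M\<close>
    makes at most M E / 2. The numerator of the weight stays between M E / 2 and 2 M E, the
    denominator between 1 and N B.\<close>
  have W_bound: "M ^ card t / (2 * N * B) \<le> W t \<and> W t \<le> 2 * M ^ card t" if "t \<in> T" for t
    using that
  proof (induction "card t" arbitrary: t rule: less_induct)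
    case less
    let ?t = t
    define E where "E = M ^ (card t - 1)"
    have E0: "E > 0" using M by (simp add: E_def)
    have "card t > 0" using proper_pipe_card[OF pp[OF less.prems]] by simp
    then have ME: "M ^ card t = M * E" unfolding E_def by (metis Suc_diff_1 power_Suc)
    have "0 \<le> W s \<and> W s \<le> 2 * E" if s: "s \<in> T" "s \<subset> t" for s
    proof -
      have c: "card s \<le> card t - 1" using psub[OF s] less.prems U[OF less.prems] by (simp add: e_def)
      then have "card s < card t" using \<open>card t > 0\<close> by linarith
      then have "M ^ card s / (2 * N * B) \<le> W s \<and> W s \<le> 2 * M ^ card s" using less.hyps s by blast
      moreover have "M ^ card s \<le> E" unfolding E_def using c M by (intro power_increasing) auto
      moreover have "0 \<le> M ^ card s / (2 * N * B)" using M N1 B by simp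
      ultimately show ?thesis by linarith
    qed
    then have Yb: "\<bar>Y t i\<bar> \<le> 2 * real n * B * E" for i using tail_bound[of E t i] E0 by simp
    have D: "Y t j - Y t i \<le> 4 * real n * B * E" "- Y t j - - Y t i \<le> 4 * real n * B * E" for i j
      using Yb[of i] Yb[of j] by linarith+
    have nn: "0 \<le> 4 * real n * B * E" using E0 B by simp
    have "gap_sum t (\<lambda>i. - Y t i) = - gap_sum t (Y t)"
      using gap_sum_affine[of t "- 1" "Y t" "\<lambda>_. 0"] by (simp add: gap_sum_def)
    then have "\<bar>gap_sum t (Y t)\<bar> \<le> N * (4 * real n * B * E)"
      using gap_sum_le[OF pp[OF less.prems] nn, of "Y t"] gap_sum_le[OF pp[OF less.prems] nn, of "\<lambda>i. - Y t i"] D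
      unfolding N_def by (simp add: abs_le_iff)
    also have "\<dots> = (8 * real n ^ 3 * B) * E / 2"
      by (simp add: N_def power2_eq_square power3_eq_cube)
    also have "\<dots> \<le> M * E / 2" using M(1) E0 by (intro divide_right_mono mult_right_mono) auto
    finally have stuff: "\<bar>gap_sum t (Y t)\<bar> \<le> M * E / 2" .
    have W: "W t = (M * E - gap_sum t (Y t)) / gap_sum t (H t)"
      using weight_eq[OF T less.prems, of M] ME by (simp add: W_def Y_def H_def)
    have MEpos: "M * E > 0" using M E0 by simp
    have "(M * E / 2) / (N * B) \<le> W t"
      unfolding W using stuff g[OF less.prems] MEpos by (intro frac_le) linarith+
    moreover have "W t \<le> (2 * (M * E)) / 1"
      unfolding W using stuff g[OF less.prems] MEpos by (intro frac_le) linarith+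
    ultimately show ?case by (simp add: ME)
  qed
  have W0: "0 \<le> W t" if "t \<in> T" for t
  proof -
    have "0 \<le> M ^ card t / (2 * N * B)" using M N1 B by simp
    then show ?thesis using W_bound[OF that] by linarith
  qed
  have diff: "X j - X i = V t * (H t j - H t i) + (Y t j - Y t i)"
    if "t \<in> insert UNIV T" "i \<in> t" "j \<in> t" for t i j
  proof (cases "t = UNIV")
    case True
    then show ?thesis
      by (simp add: X_def realization_def[OF T] V_def H_def Y_def algebra_simps)
  next
    case False
    then show ?thesis using realization_diff[OF T, of t i j M] that
      by (simp add: X_def V_def W_def H_def Y_def)
  qed
  \<comment> \<open>The height contributes at least \<open>V t\<close>, the tail takes away at most
    4 n B E. The second bound on \<open>M\<close> is exactly what makes \<open>V t\<close> exceed (4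
    n B + 1) E.\<close>
  have gap: "M ^ (e t - 1) < X j - X i"
    if t: "t \<in> insert UNIV T" and ij: "i \<in> t" "j \<in> t" "lt i j" "\<And>s. s \<in> inner_tubes T t \<Longrightarrow> i \<in> s \<Longrightarrow> j \<notin> s" for t i j
  proof -
    define E where "E = M ^ (e t - 1)"
    have E0: "E > 0" using M by (simp add: E_def)
    have "e t > 0" using t proper_pipe_card[OF pp, of t] by (auto simp: e_def)
    then have ME: "M ^ e t = M * E" unfolding E_def by (metis Suc_diff_1 power_Suc)
    have "0 \<le> W s \<and> W s \<le> 2 * E" if s: "s \<in> T" "s \<subset> t" for s
    proof -
      have "M ^ card s \<le> E" unfolding E_def using psub[OF s t] M by (intro power_increasing) auto
      then show ?thesis using W_bound[OF s(1)] W0[OF s(1)] by linarith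
    qed
    then have Yb: "\<bar>Y t i\<bar> \<le> 2 * real n * B * E" for i using tail_bound[of E t i] E0 by simp
    have V: "M * E / (2 * N * B) \<le> V t"
    proof (cases "t = UNIV")
      case True
      have "1 * 1 \<le> N * B" using N1 B by (intro mult_mono) auto
      then have "1 \<le> 2 * N * B" by linarith
      then have "M * E / (2 * N * B) \<le> M * E / 1" using M E0 by (intro frac_le) auto
      then show ?thesis using True by (simp add: V_def e_def E_def)
    next
      case False
      then show ?thesis using W_bound[of t] t ME by (auto simp: V_def e_def)
    qed
    have "2 * N * B > 0" using N1 B by simp
    have "(4 * real n * B + 1) * (2 * N * B) < M" using M(2) by (simp add: N_def ac_simps)
    then have "4 * real n * B + 1 < M / (2 * N * B)" using \<open>2 * N * B > 0\<close> by (simp add: pos_less_divide_eq)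
    then have "(4 * real n * B + 1) * E < M / (2 * N * B) * E" using E0 by (rule mult_strict_right_mono)
    then have big: "4 * real n * B * E + E < V t" using V by (simp add: algebra_simps)
    have "0 \<le> V t" using V M E0 N1 B by (intro order_trans[OF _ V]) simp
    moreover have "1 \<le> H t j - H t i"
      unfolding H_def le_diff_eq by (subst add.commute) (rule height_less[OF T ij(3,4)])
    ultimately have "V t * 1 \<le> V t * (H t j - H t i)" by (intro mult_left_mono)
    then show ?thesis using big Yb[of i] Yb[of j] diff[OF t ij(1,2)] unfolding E_def[symmetric] by linarith
  qed
  have X_mono: "X i \<le> X j" if "le i j" for i j
  proof (cases "i = j")
    case False
    obtain t where t: "t \<in> insert UNIV T" "{i, j} \<subseteq> t" "\<And>s. s \<in> inner_tubes T t \<Longrightarrow> \<not> {i, j} \<subseteq> s"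
      using inner_tubes_minimal[OF T, of "{i, j}"] by blast
    have "M ^ (e t - 1) < X j - X i"
      using t that False by (intro gap) (auto simp: strict_def)
    moreover have "0 \<le> M ^ (e t - 1)" using M by simp
    ultimately show ?thesis by linarith
  qed simp
  have in_T: "gap_sum t X = M ^ card t" if t: "t \<in> T" for t
  proof -
    have "gap_sum t X = gap_sum t (\<lambda>i. W t * H t i + Y t i)"
      using diff[of t] t U[OF t] by (intro gap_sum_cong) (auto simp: V_def algebra_simps)
    also have "\<dots> = W t * gap_sum t (H t) + gap_sum t (Y t)" by (rule gap_sum_affine)
    also have "\<dots> = M ^ card t"
      using weight_eq[OF T t, of M] g(1)[OF t] by (simp add: W_def Y_def H_def)
    finally show ?thesis .
  qed
  \<comment> \<open>The smallest tube \<open>t\<close> around \<open>r\<close> is strictly larger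
    than \<open>r\<close>, so a single pair of \<open>r\<close> sharing no inner tube of
    \<open>t\<close> already exceeds the required \<open>M ^ card r\<close>.\<close>
  have out_T: "M ^ card r < gap_sum r X" if r: "proper_pipe n le r" "r \<notin> T" for r
  proof -
    obtain t where t: "t \<in> insert UNIV T" "r \<subseteq> t" "\<And>s. s \<in> inner_tubes T t \<Longrightarrow> \<not> r \<subseteq> s"
      using inner_tubes_minimal[OF T proper_pipe_nonempty[OF r(1)]] by blast
    obtain i j where ij: "i \<in> r" "j \<in> r" "lt i j" "\<And>s. s \<in> inner_tubes T t \<Longrightarrow> i \<in> s \<Longrightarrow> j \<notin> s"
      using piping_exit[OF inner_tubes_piping[OF T] r(1) t(3)] by blast
    have "r \<noteq> UNIV" using r by (simp add: proper_pipe_def)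
    then have "r \<subset> t" using t r by blast
    then have "card r \<le> e t - 1"
      using t proper_pipe_card_le[OF r(1)] psubset_card_mono[of t r] proper_pipe_finite[OF pp, of t]
      by (auto simp: e_def)
    then have "M ^ card r \<le> M ^ (e t - 1)" using M by (intro power_increasing) auto
    also have "\<dots> < X j - X i" using t ij by (intro gap) auto
    also have "\<dots> \<le> gap_sum r X"
      using X_mono ij proper_pipe_finite[OF r(1)] by (intro gap_le_gap_sum)
    finally show ?thesis .
  qed
  show "feasible M (realization T M)"
    unfolding feasible_def using realization_quasi[OF T] in_T out_T
    by (auto simp: X_def order_less_imp_le) (metis order_less_imp_le order_refl)
  show "active M (realization T M) = T"
    unfolding active_def using in_T out_T pp by (force simp: X_def)
qed

section \<open>The dual polytope\<close>

lemma piping_empty: "proper_piping n le {}"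
  by (rule proper_pipingI) (auto simp: piping_digraph_def acyclic_def)

text \<open>Shows that every vertex is a simplex. Translates of a pipe are equal or disjoint, and by
  convexity an edge leads only to a higher translate, which \<open>Min\<close> detects.\<close>

lemma piping_pipe_class:
  assumes t: "proper_pipe n le t"
  shows "proper_piping n le (pipe_class n t)"
proof (rule proper_pipingI)
  have Min: "Min (shift d t) = Min t + d * int n" for d
    using mono_Min_commute[of "\<lambda>i. i + d * int n" t] proper_pipe_finite[OF t] proper_pipe_nonempty[OF t]
    by (simp add: mono_def)
  have "Min s < Min s'" if edge: "(s, s') \<in> piping_digraph le (pipe_class n t)" for s s'
  proof -
    obtain d e where de: "s = shift d t" "s' = shift e t"
      using edge by (auto simp: piping_digraph_def pipe_class_def)
    obtain i j where ij: "i \<in> t" "j \<in> t" "lt (i + d * int n) (j + e * int n)" "s \<inter> s' = {}"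
      using edge de by (auto simp: piping_digraph_def)
    have "d \<noteq> e" using ij de by blast
    moreover have "\<not> e < d"
    proof
      assume "e < d"
      then have "le i (i + (d - e) * int n)" by (intro le_add_mult) simp
      moreover have "le (i + (d - e) * int n) j"
        using ij(3) le_shift[of "i + (d - e) * int n" e j] by (simp add: strict_def algebra_simps)
      ultimately have "i + (d - e) * int n \<in> t"
        using poset_convexD[OF proper_pipe_convex[OF t] ij(1,2)] by blast
      then show False using proper_pipe_shift_mem[OF t ij(1)] \<open>e < d\<close> by fastforce
    qed
    ultimately have "d * int n < e * int n" using n_pos by (intro mult_strict_right_mono) auto
    then show ?thesis by (simp add: de Min)
  qed
  then show "acyclic (piping_digraph le (pipe_class n t))"
    by (intro acyclicI_order[of _ "\<lambda>s. - Min s"]) auto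
  show "shift e s \<in> pipe_class n t" if s: "s \<in> pipe_class n t" for s e
    using s unfolding pipe_class_def mem_Collect_eq by (metis shift_shift)
  show "s \<subseteq> s' \<or> s' \<subseteq> s \<or> s \<inter> s' = {}" if s: "s \<in> pipe_class n t" "s' \<in> pipe_class n t" for s s'
  proof (cases "s \<inter> s' = {}")
    case False
    obtain d e where de: "s = shift d t" "s' = shift e t"
      using s by (auto simp: pipe_class_def)
    then obtain i j where "i \<in> t" "j \<in> t" "i + d * int n = j + e * int n" using False by blast
    then have "d - e = 0"
      using proper_pipe_shift_mem[OF t, of i "d - e"] by (simp add: algebra_simps)
    then show ?thesis using de by simp
  qed simp
  show "proper_pipe n le s" if s: "s \<in> pipe_class n t" for s
    using s proper_pipe_shift[OF t] by (auto simp: pipe_class_def)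
qed

lemma mem_pipe_class: "t \<in> pipe_class n t"
  unfolding pipe_class_def by (auto intro!: exI[of _ 0])

lemma pipe_class_image: "pipe_class n ` pipe_class n t = {pipe_class n t}"
proof -
  have "pipe_class n s = pipe_class n t" if s: "s \<in> pipe_class n t" for s
  proof -
    obtain d where "s = shift d t" using s by (auto simp: pipe_class_def)
    then show ?thesis by (simp only: pipe_class_shift)
  qed
  then show ?thesis using mem_pipe_class by blast
qed

lemma dual_polytope_exists:
  assumes dim: "n \<le> DIM('a::euclidean_space) + 1"
  shows "\<exists>C :: 'a set. simplicial_polytope C \<and> aff_dim C = int n - 1 \<and>
           scomplex_iso (boundary_complex C) (piping_complex n le)"
proof -
  obtain B :: real where B: "B \<ge> 1"
    "\<And>T h t i j. is_height T h \<Longrightarrow> proper_pipe n le t \<Longrightarrow> i \<in> t \<Longrightarrow> j \<in> t \<Longrightarrow> \<bar>of_int (h i) - of_int (h j)\<bar> \<le> B"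
    using height_bound by blast
  define M where "M = 8 * real n ^ 3 * B + 2 * real n ^ 2 * B * (4 * real n * B + 1) + 2 * real n ^ 4 + 2"
  have "0 \<le> 8 * real n ^ 3 * B" "0 \<le> 2 * real n ^ 2 * B * (4 * real n * B + 1)" "0 \<le> 2 * real n ^ 4"
    using B(1) by auto
  then have M: "M \<ge> 8 * real n ^ 3 * B" "M > 2 * real n ^ 2 * B * (4 * real n * B + 1)" "M > 1"
    "M > 2 * real n ^ 4 + 1"
    unfolding M_def by linarith+
  have realization: "feasible M (realization T M)" "active M (realization T M) = T"
    if T: "proper_piping n le T" for T
    by (rule realization_correct[OF T B(1) _ M(1-3)]; rule B(2); assumption)+
  define cls where "cls = pipe_class n"
  define I where "I = cls ` {t. proper_pipe n le t}"
  define K where "K = {cls ` T | T. proper_piping n le T}"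
  \<comment> \<open>No inequality is active at the realization of the empty piping. With this point
    as origin all slacks are positive, and every inequality can be scaled to right-hand side
    1.\<close>
  define p where "p = realization {} M"
  define slack where "slack t = gap_sum t p - M ^ card t" for t
  have p: "feasible M p" "active M p = {}"
    unfolding p_def using realization[OF piping_empty] by auto
  have slack: "slack t > 0" if "proper_pipe n le t" for t
  proof -
    have "M ^ card t \<le> gap_sum t p" "M ^ card t \<noteq> gap_sum t p"
      using p that by (auto simp: feasible_def active_def)
    then show ?thesis by (simp add: slack_def)
  qed
  have "card {1..<int n} \<le> card (Basis :: 'a set)" using dim by simp
  then obtain b :: "int \<Rightarrow> 'a" where b: "b ` {1..<int n} \<subseteq> Basis" "inj_on b {1..<int n}"
    using card_le_inj[of "{1..<int n}" "Basis :: 'a set"] by auto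
  have bb: "b r \<bullet> b s = (if r = s then 1 else 0)" if "r \<in> {1..<int n}" "s \<in> {1..<int n}" for r s
    using that b by (subst inner_Basis) (auto simp: inj_on_eq_iff)
  \<comment> \<open>Coordinates for n-periodic functions modulo constants: the value on the residue
    class 0 is normalized to 0, the other n - 1 classes use distinct orthonormal vectors.\<close>
  define c where "c i = (if i mod int n = 0 then 0 else b (i mod int n))" for i
  define u where "u a i = a \<bullet> c i" for a i
  have u0: "u a 0 = 0" for a by (simp add: u_def c_def)
  have u_quasi: "quasi_periodic 0 (u a)" for a by (simp add: quasi_periodic_def u_def c_def)
  define w where "w t = (\<Sum>(i, j)\<in>pairs t. c j - c i)" for t
  have aw: "a \<bullet> w t = gap_sum t (u a)" for a t
    by (simp add: w_def gap_sum_def inner_sum_right case_prod_unfold u_def inner_diff_right)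
  \<comment> \<open>The sign turns lower bounds on gap sums into upper bounds on inner products. By
    \<open>av\<close> the chosen representative is immaterial.\<close>
  define v where "v k = (let t = SOME t. t \<in> k in - (w t /\<^sub>R slack t))" for k
  have av: "a \<bullet> v (cls t) = - (gap_sum t (u a) / slack t)" if t: "proper_pipe n le t" for a t
  proof -
    have "(SOME s. s \<in> cls t) \<in> cls t" unfolding cls_def using mem_pipe_class by (rule someI)
    then obtain d where d: "(SOME s. s \<in> cls t) = shift d t" by (auto simp: cls_def pipe_class_def)
    have "card (shift d t) = card t" by (simp add: card_image inj_on_def)
    then have "slack (shift d t) = slack t"
      using gap_sum_shift_quasi[OF feasible_quasi[OF p(1)]] by (simp add: slack_def)
    then show ?thesis
      unfolding v_def Let_def d
      using gap_sum_shift_quasi[OF u_quasi] by (simp add: aw divide_inverse ac_simps)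
  qed
  define X where "X a i = p i + u a i" for a i
  have gX: "gap_sum t (X a) = gap_sum t p + gap_sum t (u a)" for t a
    using gap_sum_affine[of t 1 p "u a"] by (simp add: X_def[abs_def])
  have X_quasi: "quasi_periodic (real n * M ^ Suc n) (X a)" for a
    using feasible_quasi[OF p(1)] u_quasi by (simp add: quasi_periodic_def X_def)
  have le1: "a \<bullet> v (cls t) \<le> 1 \<longleftrightarrow> M ^ card t \<le> gap_sum t (X a)"
    and eq1: "a \<bullet> v (cls t) = 1 \<longleftrightarrow> gap_sum t (X a) = M ^ card t" if t: "proper_pipe n le t" for a t
    using slack[OF t] unfolding av[OF t] gX by (auto simp: slack_def field_simps)
  have feas: "(\<forall>k\<in>I. a \<bullet> v k \<le> 1) \<longleftrightarrow> feasible M (X a)" for a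
    using le1 X_quasi by (auto simp: I_def feasible_def)
  have active: "{k \<in> I. a \<bullet> v k = 1} = cls ` active M (X a)" for a
    using eq1 by (auto simp: I_def active_def)
  \<comment> \<open>A recession direction is monotone and n-periodic. Every integer lies below a
    translate of every other, so it is constant, and it vanishes at 0.\<close>
  have u_zero: "u a = (\<lambda>_. 0)" if a: "\<And>k. k \<in> I \<Longrightarrow> a \<bullet> v k \<le> 0" for a
  proof -
    have "gap_sum t (u a) \<ge> 0" if t: "proper_pipe n le t" for t
      using a[of "cls t"] av[OF t, of a] slack[OF t] t by (auto simp: I_def field_simps)
    then have mono: "u a i \<le> u a j" if "le i j" for i j
      using gap_sum_nonneg_mono[OF u_quasi _ _ that] by auto
    obtain q where q: "q \<ge> 0" "\<And>i j. i + q \<le> j \<Longrightarrow> le i j" using far_le by blast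
    have "u a i \<le> u a j" for i j
    proof -
      let ?d = "\<bar>i - j\<bar> + q"
      have "?d * 1 \<le> ?d * int n" using q n_pos by (intro mult_left_mono) auto
      then have "u a i \<le> u a (j + ?d * int n)" by (intro mono q(2)) auto
      then show ?thesis using u_quasi[of a] by (simp add: quasi_periodic_def)
    qed
    then have "u a i = 0" for i using u0[of a] by (metis order_antisym)
    then show ?thesis by blast
  qed
  have rec: "a \<bullet> v k = 0" if a: "\<And>k. k \<in> I \<Longrightarrow> a \<bullet> v k \<le> 0" and k: "k \<in> I" for a k
    using av u_zero[OF a] k by (auto simp: I_def gap_sum_def)
  have act: "{k \<in> I. a \<bullet> v k = 1} \<in> K" if a: "\<And>k. k \<in> I \<Longrightarrow> a \<bullet> v k \<le> 1" for a
  proof -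
    have "feasible M (X a)" using a feas by blast
    then have "proper_piping n le (active M (X a))" using M(4) by (rule active_piping)
    then show ?thesis unfolding active K_def by blast
  qed
  have att: "\<exists>a. (\<forall>k\<in>I. a \<bullet> v k \<le> 1) \<and> {k \<in> I. a \<bullet> v k = 1} = S" if S: "S \<in> K" for S
  proof -
    obtain T where T: "proper_piping n le T" "S = cls ` T" using S by (auto simp: K_def)
    define y where "y = realization T M"
    have y: "feasible M y" "active M y = T" unfolding y_def using realization[OF T(1)] by auto
    \<comment> \<open>Feasible points have the same period constant, so \<open>d\<close> is
      n-periodic. Subtracting \<open>d 0\<close> makes it representable by a vector and changes no
      gap sum.\<close>
    define d where "d i = y i - p i" for i
    have d: "d (i mod int n) = d i" for i
    proof -
      have i: "i mod int n + i div int n * int n = i" by simp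
      have "quasi_periodic 0 d"
        using feasible_quasi[OF y(1)] feasible_quasi[OF p(1)] by (simp add: quasi_periodic_def d_def)
      then have "d (i mod int n + i div int n * int n) = d (i mod int n)"
        by (simp only: quasi_periodic_def)
      then show ?thesis unfolding i by simp
    qed
    define a where "a = (\<Sum>r\<in>{1..<int n}. (d r - d 0) *\<^sub>R b r)"
    have ua: "u a i = d i - d 0" for i
    proof (cases "i mod int n = 0")
      case True
      then show ?thesis using d[of i] by (simp add: u_def c_def)
    next
      case False
      moreover have "0 \<le> i mod int n" "i mod int n < int n" using n_pos by auto
      ultimately have r: "i mod int n \<in> {1..<int n}" by auto
      have "a \<bullet> b (i mod int n) = (\<Sum>r\<in>{1..<int n}. if r = i mod int n then d r - d 0 else 0)"
        unfolding a_def inner_sum_left using bb[OF _ r] by (intro sum.cong) auto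
      also have "\<dots> = d (i mod int n) - d 0" using r by (simp add: sum.delta)
      finally show ?thesis using False d[of i] by (simp add: u_def c_def)
    qed
    have "gap_sum t (X a) = gap_sum t y" for t
      by (rule gap_sum_cong) (simp add: X_def ua d_def)
    then have "feasible M (X a)" "active M (X a) = T"
      using y X_quasi by (auto simp: feasible_def active_def)
    then show ?thesis using feas active T(2) by blast
  qed
  have sub: "S' \<in> K" if S: "S \<in> K" "S' \<subseteq> S" for S S'
  proof -
    obtain T where T: "proper_piping n le T" "S = cls ` T" using S by (auto simp: K_def)
    \<comment> \<open>Selecting by class keeps or drops whole classes, which preserves
      periodicity.\<close>
    let ?T = "{t \<in> T. cls t \<in> S'}"
    have "proper_piping n le ?T"
      using piping_shift[OF T(1)] pipe_class_shift by (intro proper_piping_subset[OF T(1)]) (auto simp: cls_def)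
    moreover have "S' = cls ` ?T" using S T by auto
    ultimately show ?thesis unfolding K_def by blast
  qed
  have vert: "{k} \<in> K" if k: "k \<in> I" for k
  proof -
    obtain t where t: "proper_pipe n le t" "k = cls t" using k by (auto simp: I_def)
    then have "{k} = cls ` pipe_class n t" using pipe_class_image by (simp add: cls_def)
    then show ?thesis using piping_pipe_class[OF t(1)] unfolding K_def by blast
  qed
  \<comment> \<open>This fixes the dimension at n - 1: a vector orthogonal to all \<open>v k\<close>
    is a recession direction, so by \<open>u_zero\<close> it is orthogonal to every coordinate
    vector too.\<close>
  have span: "span (v ` I) = span (b ` {1..<int n})"
  proof (rule ccontr)
    assume neq: "\<not> ?thesis"
    have "c i \<in> span (b ` {1..<int n})" for i
    proof (cases "i mod int n = 0")
      case False
      moreover have "0 \<le> i mod int n" "i mod int n < int n" using n_pos by auto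
      ultimately have "i mod int n \<in> {1..<int n}" by auto
      then show ?thesis using False by (simp add: c_def span_base)
    qed (simp add: c_def span_zero)
    then have "w t \<in> span (b ` {1..<int n})" for t
      unfolding w_def by (intro span_sum) (auto intro: span_diff)
    then have "v ` I \<subseteq> span (b ` {1..<int n})"
      unfolding v_def Let_def by (auto intro: span_neg span_scale)
    then have "span (v ` I) \<subset> span (b ` {1..<int n})"
      using neq span_minimal subspace_span by blast
    then obtain x where x: "x \<noteq> 0" "x \<in> span (b ` {1..<int n})" "\<And>y. y \<in> span (v ` I) \<Longrightarrow> orthogonal x y"
      using orthogonal_to_subspace_exists_gen by blast
    have "x \<bullet> v k \<le> 0" if "k \<in> I" for k
      using x(3)[of "v k"] that by (simp add: span_base orthogonal_def)
    then have "u x = (\<lambda>_. 0)" by (rule u_zero)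
    then have ux: "x \<bullet> c r = 0" for r unfolding u_def by meson
    have "x \<bullet> b r = 0" if "r \<in> {1..<int n}" for r
      using ux[of r] that by (simp add: c_def)
    then have "b ` {1..<int n} \<subseteq> {y. x \<bullet> y = 0}" by blast
    then have "span (b ` {1..<int n}) \<subseteq> {y. x \<bullet> y = 0}"
      by (intro span_minimal subspace_hyperplane)
    then show False using x by auto
  qed
  have "independent (b ` {1..<int n})" using b(1) independent_Basis independent_mono by blast
  then have "dim (b ` {1..<int n}) = card (b ` {1..<int n})" by (rule dim_eq_card_independent)
  also have "\<dots> = n - 1" using b(2) by (simp add: card_image)
  finally have dimv: "dim (v ` I) = n - 1" using span by (metis dim_span)
  have finI: "finite I" unfolding I_def cls_def by (rule finite_pipe_classes)
  have "piping_complex n le = (I, K)" by (simp add: piping_complex_def I_def K_def cls_def)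
  then show ?thesis
    using polar_dual_simplicial[OF finI rec act att sub vert] dimv n_pos
    by (intro exI[of _ "convex hull (insert 0 (v ` I))"]) (simp add: of_nat_diff)
qed

end

theorem theorem1p12:
  fixes n :: nat and le :: "int \<Rightarrow> int \<Rightarrow> bool"
  assumes "affine_poset n le"
    and "n \<le> DIM('a::euclidean_space) + 1"
  shows "\<exists>C :: 'a set. simplicial_polytope C \<and> aff_dim C = int n - 1 \<and>
           scomplex_iso (boundary_complex C) (piping_complex n le)"
proof -
  interpret affine_order n le
    by unfold_locales (rule assms)
  show ?thesis using assms(2) by (rule dual_polytope_exists)
qed

end
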